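(* Let $\Omega\subset\mathbb R^n$ be a bounded domain, $1\le m\le n$, $Q=\Omega\times(0,\infty)$. Let $\mathbf u\in C^2(\bar\Omega)$ be $m$-admissible, $\mathbf f=T_m(\mathbf u_{xx})$, $\Phi=\mathbf u|_{\partial\Omega}$. Let $u\in C^{2,1}(Q)\cap C(\bar\Omega\times[0,\infty))$. Assume there is $(x_0,t_0)\in Q$ such that $u_{xx}(x_0,t_0)$ is $m$-positive, and constants $0<\nu\le\mu$ with $\nu\le E_m[u]\le\mu$ in $Q_0=\Omega\times[t_0,\infty)$. Assume there are continuous non-increasing functions $h_1^+,h_2^+,h^-:[t_0,\infty)\to(0,\infty)$ with $h_2^+(t_0)<\frac1m$ such that $-h^-(t_0)\le u(x,t_0)-\mathbf u(x)\le h_1^+(t_0)$ for $x\in\Omega$; $-h^-(t)\le u(x,t)-\Phi(x)\le h_1^+(t)$ for $x\in\partial\Omega$, $t\ge t_0$; and $-h^-(t)\le\frac1m\big(1-\frac{E_m[u]}{\mathbf f}\big)\le h_2^+(t)$ in $Q_0$. Then $\sup_{\bar\Omega\times[0,\infty)}|u|<\infty$. If in addition $h_1^+(t),h_2^+(t),h^-(t)\to0$ as $t\to\infty$, then $\sup_{x\in\bar\Omega}|u(x,t)-\mathbf u(x)|\to0$ as $t\to\infty$.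
   Context: For $S\in\mathrm{Sym}(n)$ and $0\le p\le n$, $T_p(S)$ is the sum of all principal $p\times p$ minors of $S$, with $T_0(S)=1$. $K_m=\{S\in\mathrm{Sym}(n):T_p(S)>0,\ p=1,\dots,m\}$; $S$ is $m$-positive if $S\in K_m$. A function $\mathbf u\in C^2(\bar\Omega)$ is $m$-admissible if $\mathbf u_{xx}(x)\in K_m$ for all $x\in\bar\Omega$. For $u(x,t)$, $u_{xx}$ is its Hessian in $x$ and $E_m[u]=-u_t\,T_{m-1}(u_{xx})+T_m(u_{xx})$. *)

theory Defs
  imports "HOL-Analysis.Analysis"
begin

definition principal_minor :: "real^'n^'n \<Rightarrow> 'n set \<Rightarrow> real" where
  "principal_minor S I = (\<Sum>p | p permutes I. of_int (sign p) * (\<Prod>i\<in>I. S $ i $ p i))"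

text \<open>T_p(S): sum of all principal p x p minors (T_0 S = 1).\<close>
definition Tsum :: "nat \<Rightarrow> real^'n^'n \<Rightarrow> real" where
  "Tsum p S = (\<Sum>I | I \<subseteq> (UNIV :: 'n set) \<and> card I = p. principal_minor S I)"

definition Kcone :: "nat \<Rightarrow> (real^'n^'n) set" where
  "Kcone m = {S. transpose S = S \<and> (\<forall>p\<in>{1..m}. Tsum p S > 0)}"

definition pd :: "'n::finite \<Rightarrow> (real^'n \<Rightarrow> real) \<Rightarrow> real^'n \<Rightarrow> real" where
  "pd i f x = vector_derivative (\<lambda>s. f (x + s *\<^sub>R axis i 1)) (at 0)"

definition pd_exists :: "'n::finite \<Rightarrow> (real^'n \<Rightarrow> real) \<Rightarrow> real^'n \<Rightarrow> bool" where
  "pd_exists i f x \<longleftrightarrow> (\<lambda>s. f (x + s *\<^sub>R axis i 1)) differentiable (at 0)"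

definition hess :: "(real^'n \<Rightarrow> real) \<Rightarrow> real^'n \<Rightarrow> real^'n^'n" where
  "hess f x = (\<chi> i j. pd i (pd j f) x)"

definition C2_on :: "(real^'n) set \<Rightarrow> (real^'n \<Rightarrow> real) \<Rightarrow> bool" where
  "C2_on U f \<longleftrightarrow> continuous_on U f \<and>
     (\<forall>i. \<forall>x\<in>U. pd_exists i f x) \<and> (\<forall>i. continuous_on U (pd i f)) \<and>
     (\<forall>i j. \<forall>x\<in>U. pd_exists i (pd j f) x) \<and> (\<forall>i j. continuous_on U (pd i (pd j f)))"

definition C2_closure_with_hess ::
    "(real^'n) set \<Rightarrow> (real^'n \<Rightarrow> real) \<Rightarrow> (real^'n \<Rightarrow> real^'n^'n) \<Rightarrow> bool" where
  "C2_closure_with_hess U f H \<longleftrightarrow> C2_on U f \<and> continuous_on (closure U) f \<and>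
     (\<forall>i. \<exists>g. continuous_on (closure U) g \<and> (\<forall>x\<in>U. g x = pd i f x)) \<and>
     continuous_on (closure U) H \<and> (\<forall>x\<in>U. H x = hess f x)"

definition ut :: "(real^'n \<Rightarrow> real \<Rightarrow> real) \<Rightarrow> real^'n \<Rightarrow> real \<Rightarrow> real" where
  "ut v x t = vector_derivative (\<lambda>s. v x s) (at t)"

definition uxx :: "(real^'n \<Rightarrow> real \<Rightarrow> real) \<Rightarrow> real^'n \<Rightarrow> real \<Rightarrow> real^'n^'n" where
  "uxx v x t = hess (\<lambda>y. v y t) x"

definition C21_on :: "((real^'n) \<times> real) set \<Rightarrow> (real^'n \<Rightarrow> real \<Rightarrow> real) \<Rightarrow> bool" where
  "C21_on Q v \<longleftrightarrow> continuous_on Q (\<lambda>(x,t). v x t) \<and>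
     (\<forall>(x,t)\<in>Q. (\<lambda>s. v x s) differentiable (at t)) \<and>
     continuous_on Q (\<lambda>(x,t). ut v x t) \<and>
     (\<forall>i. \<forall>(x,t)\<in>Q. pd_exists i (\<lambda>y. v y t) x) \<and>
     (\<forall>i. continuous_on Q (\<lambda>(x,t). pd i (\<lambda>y. v y t) x)) \<and>
     (\<forall>i j. \<forall>(x,t)\<in>Q. pd_exists i (pd j (\<lambda>y. v y t)) x) \<and>
     (\<forall>i j. continuous_on Q (\<lambda>(x,t). pd i (pd j (\<lambda>y. v y t)) x))"

definition Em :: "nat \<Rightarrow> (real^'n \<Rightarrow> real \<Rightarrow> real) \<Rightarrow> real^'n \<Rightarrow> real \<Rightarrow> real" where
  "Em m v x t = - ut v x t * Tsum (m - 1) (uxx v x t) + Tsum m (uxx v x t)"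

end

(* On a set where E_m[u] stays positive, u_xx cannot leave the cone K_(m-1): at a limit point with
   T_(m-1) = 0 one would have T_m > 0, against the Maclaurin inequality. The comparison functions are
   then multiples of the stationary solution: at an interior maximum of u - c u0 + theta t, 0 <= c <= 1,
   one has S = u_xx <= c H, and monotonicity of T_(m-1) and T_m on the cones gives
   E_m[u] <= theta T_(m-1)(H) + c^m T_m(H), which contradicts the lower bound on E_m[u] / T_m(H) once
   c = 1 - eps and h2 and theta are small. At an interior minimum of u - c u0 - theta t, c = 1 + eps,
   u_xx >= c H lies in K_m and T_(m-1) has no upper bound; there monotonicity of T_m / T_(m-1) is used
   instead. The term theta t makes the influence of the initial values die out, while c = 0 and
   c = 2 + hm(t0) with theta = 0 give boundedness.

   No eigenvalues are needed: Newton's inequality holds because det(1 + x S) has only real roots, and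
   applied to all members of the affine pencil A + tau P with P of rank one it yields the monotonicity
   of T_p and T_p / T_(p-1) on the cones. *)

theory Submission
  imports Defs "HOL-Computational_Algebra.Fundamental_Theorem_Algebra"
begin

section \<open>Newton's inequality for real-rooted polynomials\<close>

text \<open>The comparison function is c u0 rather than u0 because c = 1 leaves no room: at a
  maximum, u_xx \<le> H only gives E_m[u] \<le> \<theta> T_(m-1)(H) + T_m(H), which contradicts
  nothing. The factor c^m differs from 1 by an amount that absorbs both \<theta> and the relative
  error of E_m[u]. The price is an error \<bar>1 - c\<bar> sup \<bar>u0\<bar> on the boundary, so
  \<epsilon> is tied to sup \<bar>u0\<bar>. For convergence the comparison starts at a late time
  \<tau>: h1, h2 and hm are frozen there by monotonicity and are already small, whereas the size of
  u at time \<tau> is left to the term \<theta> t.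

  On the algebraic side the contact condition is only an inequality between quadratic forms. It
  splits into rank-one steps, and an orthogonal change of basis turns each of them into the change
  of one diagonal entry, along which every T_p is affine. Newton's inequality then fixes the signs
  of the slopes. It is used for parameters of both signs, also where the pencil has left the
  cone.\<close>

abbreviation cpoly :: "real poly \<Rightarrow> complex \<Rightarrow> complex" where
  "cpoly f z \<equiv> poly (map_poly complex_of_real f) z"

lemma cpoly_pCons: "cpoly (pCons a f) z = of_real a + z * cpoly f z"
  by (simp add: map_poly_pCons)

lemma cpoly_add: "cpoly (f + g) z = cpoly f z + cpoly g z"
proof -
  have "map_poly complex_of_real (f + g) = map_poly of_real f + map_poly of_real g"
    by (intro poly_eqI) (simp add: coeff_map_poly)
  then show ?thesis by simp
qed

lemma cpoly_smult: "cpoly (smult a f) z = of_real a * cpoly f z"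
  by (simp add: map_poly_smult)

lemma cpoly_mult: "cpoly (f * g) z = cpoly f z * cpoly g z"
  by (induction f) (simp_all add: cpoly_pCons cpoly_add cpoly_smult mult_pCons_left algebra_simps)

text \<open>The case a = 0 admits the zero polynomial, so the class is closed under derivatives
  without conditions on the degree.\<close>

definition real_split :: "real poly \<Rightarrow> bool" where
  "real_split f \<longleftrightarrow> (\<exists>a rs. f = smult a (\<Prod>r\<leftarrow>rs. [:- r, 1:]))"

text \<open>Induction on the degree: the fundamental theorem of algebra gives a root, the hypothesis
  makes it real, and the quotient by its linear factor inherits the hypothesis.\<close>

lemma real_split_if_roots_real:
  assumes "\<And>z. cpoly f z = 0 \<Longrightarrow> Im z = 0"
  shows "real_split f"
  using assms
proof (induction "degree f" arbitrary: f rule: less_induct)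
  case less
  show ?case
  proof (cases "degree f = 0")
    case True
    then obtain a where "f = [:a:]" using degree_eq_zeroE by blast
    then have "f = smult a (\<Prod>r\<leftarrow>[]. [:- r, 1:])" by simp
    then show ?thesis unfolding real_split_def by blast
  next
    case False
    have "degree (map_poly complex_of_real f) = degree f"
      by (intro degree_map_poly) auto
    with False have "\<not> constant (poly (map_poly complex_of_real f))"
      by (simp add: constant_degree)
    then obtain z where z: "cpoly f z = 0" using fundamental_theorem_of_algebra by blast
    define r where "r = Re z"
    have zr: "z = of_real r" using less.prems[OF z] by (simp add: complex_eq_iff r_def)
    have ev: "cpoly g (of_real x) = of_real (poly g x)" for g x
      by (induction g) (simp_all add: cpoly_pCons)
    have "poly f r = 0" using z unfolding zr ev by simp
    then obtain g where g: "f = [:- r, 1:] * g" by (metis dvdE poly_eq_0_iff_dvd)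
    have "g \<noteq> 0" using g False by auto
    then have "degree f = Suc (degree g)" using g degree_mult_eq[of "[:- r, 1:]" g] by simp
    moreover have "Im w = 0" if "cpoly g w = 0" for w
      using less.prems[of w] that by (simp add: g cpoly_mult del: mult_pCons_left)
    ultimately obtain a rs where "g = smult a (\<Prod>r\<leftarrow>rs. [:- r, 1:])"
      using less.hyps[of g] unfolding real_split_def by auto
    then have "f = smult a (\<Prod>r\<leftarrow>r#rs. [:- r, 1:])" unfolding g by simp
    then show ?thesis unfolding real_split_def by blast
  qed
qed

text \<open>Away from the roots, (f'^2 - f f'') / f^2 = - (log \<bar>f\<bar>)'' is the sum of 1 / (x
  - r)^2. The induction carries the version without denominators, which also holds at the
  roots.\<close>

lemma laguerre_inequality:
  assumes "real_split f"
  shows "poly f x * poly (pderiv (pderiv f)) x \<le> (poly (pderiv f) x)\<^sup>2"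
proof -
  have *: "poly g x * poly (pderiv (pderiv g)) x \<le> (poly (pderiv g) x)\<^sup>2"
    if "g = (\<Prod>r\<leftarrow>rs. [:- r, 1:])" for g rs
    using that
  proof (induction rs arbitrary: g)
    case (Cons r rs)
    define h where "h = (\<Prod>r\<leftarrow>rs. [:- r, 1:])"
    have g: "g = [:- r, 1:] * h" using Cons.prems by (simp add: h_def)
    have d1: "pderiv g = [:- r, 1:] * pderiv h + h"
      unfolding g pderiv_mult by (simp add: pderiv_pCons)
    have d2: "pderiv (pderiv g) = [:- r, 1:] * pderiv (pderiv h) + 2 * pderiv h"
      unfolding d1 pderiv_add pderiv_mult by (simp add: pderiv_pCons)
    have e0: "poly g x = (x - r) * poly h x" by (simp add: g algebra_simps)
    have e1: "poly (pderiv g) x = (x - r) * poly (pderiv h) x + poly h x"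
      unfolding d1 by (simp add: algebra_simps)
    have e2: "poly (pderiv (pderiv g)) x = (x - r) * poly (pderiv (pderiv h)) x + 2 * poly (pderiv h) x"
      unfolding d2 by (simp add: algebra_simps)
    have "(poly (pderiv g) x)\<^sup>2 - poly g x * poly (pderiv (pderiv g)) x
        = (poly h x)\<^sup>2 + (x - r)\<^sup>2 * ((poly (pderiv h) x)\<^sup>2 - poly h x * poly (pderiv (pderiv h)) x)"
      unfolding e0 e1 e2 by (simp add: power2_eq_square algebra_simps)
    also have "\<dots> \<ge> 0" using Cons.IH[OF h_def] by simp
    finally show ?case by simp
  qed simp
  obtain a rs where f: "f = smult a (\<Prod>r\<leftarrow>rs. [:- r, 1:])" using assms unfolding real_split_def by blast
  show ?thesis using mult_left_mono[OF *[OF refl, of rs], of "a\<^sup>2"]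
    unfolding f pderiv_smult poly_smult by (simp add: power2_eq_square algebra_simps)
qed

text \<open>Gauss--Lucas: off the real axis the logarithmic derivative
  \<open>\<Sum> 1 / (z - r)\<close> has an imaginary part of the opposite sign to \<open>Im z\<close>.\<close>

lemma logderiv_real_roots:
  assumes "Im z \<noteq> 0" and "g = (\<Prod>r\<leftarrow>rs. [:- r, 1:])" and "rs \<noteq> []"
  shows "cpoly g z \<noteq> 0 \<and> Im z * Im (cpoly (pderiv g) z / cpoly g z) < 0"
  using assms(2,3)
proof (induction rs arbitrary: g)
  case (Cons r rs)
  define h where "h = (\<Prod>r\<leftarrow>rs. [:- r, 1:])"
  have g: "g = [:- r, 1:] * h" using Cons.prems by (simp add: h_def)
  have d1: "pderiv g = [:- r, 1:] * pderiv h + h"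
    unfolding g pderiv_mult by (simp add: pderiv_pCons)
  define w where "w = z - of_real r"
  have w: "Im w = Im z" "w \<noteq> 0" using assms(1) by (auto simp: w_def complex_eq_iff)
  have eg: "cpoly g z = w * cpoly h z" unfolding g cpoly_mult by (simp add: cpoly_pCons w_def)
  have ed: "cpoly (pderiv g) z = w * cpoly (pderiv h) z + cpoly h z"
    unfolding d1 cpoly_mult cpoly_add by (simp add: cpoly_pCons w_def)
  have h: "cpoly h z \<noteq> 0 \<and> Im z * Im (cpoly (pderiv h) z / cpoly h z) \<le> 0"
  proof (cases "rs = []")
    case True
    then have "h = 1" by (simp add: h_def)
    then show ?thesis by simp
  next
    case False
    from Cons.IH[OF h_def this] show ?thesis by simp
  qed
  have "cpoly (pderiv g) z / cpoly g z = cpoly (pderiv h) z / cpoly h z + 1 / w"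
    unfolding eg ed using h w by (simp add: field_simps)
  moreover have "Im z * Im (1 / w) < 0"
  proof -
    have "(Re w)\<^sup>2 + (Im w)\<^sup>2 > 0" using w by (simp add: complex_neq_0)
    moreover have "Im z * Im (1 / w) = - ((Im z)\<^sup>2 / ((Re w)\<^sup>2 + (Im w)\<^sup>2))"
      using w by (simp add: Im_divide power2_eq_square)
    ultimately show ?thesis using assms(1) by simp
  qed
  ultimately show ?case using h w eg by (simp add: distrib_left)
qed simp

text \<open>A nonreal zero of f' would make the logarithmic derivative vanish, against its strict
  sign. Unlike Rolle's theorem this needs no count of multiple roots.\<close>

lemma real_split_pderiv:
  assumes "real_split f"
  shows "real_split (pderiv f)"
proof -
  obtain a rs where f: "f = smult a (\<Prod>r\<leftarrow>rs. [:- r, 1:])" using assms unfolding real_split_def by blast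
  define g where "g = (\<Prod>r\<leftarrow>rs. [:- r, 1:])"
  show ?thesis
  proof (cases "a = 0 \<or> rs = []")
    case True
    then have "pderiv f = smult 0 (\<Prod>r\<leftarrow>[]. [:- r, 1:])" unfolding f by (auto simp: pderiv_smult)
    then show ?thesis unfolding real_split_def by blast
  next
    case False
    have "Im z = 0" if "cpoly (pderiv f) z = 0" for z
    proof (rule ccontr)
      assume z: "Im z \<noteq> 0"
      have "cpoly (pderiv g) z = 0" using that False
        unfolding f pderiv_smult cpoly_smult by (simp add: g_def)
      then show False using logderiv_real_roots[OF z g_def] False by simp
    qed
    then show ?thesis by (rule real_split_if_roots_real)
  qed
qed

text \<open>Laguerre's inequality at 0 for the p-th derivative, whose value there is p! times the
  p-th coefficient. It gives the extra factor (p + 2) / (p + 1) on the left, which is dropped; this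
  weak form is independent of the degree.\<close>

lemma newton_inequality:
  assumes "real_split f"
  shows "coeff f p * coeff f (p + 2) \<le> (coeff f (p + 1))\<^sup>2"
proof -
  have split: "real_split ((pderiv ^^ k) f)" for k
    by (induction k) (simp_all add: assms real_split_pderiv)
  have c: "poly ((pderiv ^^ k) f) 0 = fact k * coeff f k" for k
    by (simp add: poly_0_coeff_0 coeff_higher_pderiv pochhammer_fact)
  have "poly ((pderiv ^^ p) f) 0 * poly ((pderiv ^^ (p+2)) f) 0 \<le> (poly ((pderiv ^^ (p+1)) f) 0)\<^sup>2"
    using laguerre_inequality[OF split, of p 0] by (simp add: numeral_2_eq_2)
  then have "(fact p)\<^sup>2 * (real (p+1) * real (p+2) * (coeff f p * coeff f (p+2)))
      \<le> (fact p)\<^sup>2 * ((real (p+1))\<^sup>2 * (coeff f (p+1))\<^sup>2)"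
    unfolding c by (simp add: power2_eq_square algebra_simps)
  then have "real (p+1) * real (p+2) * (coeff f p * coeff f (p+2)) \<le> (real (p+1))\<^sup>2 * (coeff f (p+1))\<^sup>2"
    by (rule mult_left_le_imp_le) simp
  then have *: "real (p+2) * (coeff f p * coeff f (p+2)) \<le> real (p+1) * (coeff f (p+1))\<^sup>2"
    by (simp add: power2_eq_square mult.assoc del: of_nat_add of_nat_Suc)
  \<comment> \<open>Dropping a factor above 1 on the left weakens the inequality only if the product
    is positive; otherwise the square on the right suffices.\<close>
  show ?thesis
  proof (cases "coeff f p * coeff f (p+2) \<le> 0")
    case True
    then show ?thesis by (smt (verit) zero_le_power2)
  next
    case False
    then have "real (p+1) * (coeff f p * coeff f (p+2)) \<le> real (p+2) * (coeff f p * coeff f (p+2))"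
      by (intro mult_right_mono) auto
    with * have "real (p+1) * (coeff f p * coeff f (p+2)) \<le> real (p+1) * (coeff f (p+1))\<^sup>2" by linarith
    then show ?thesis by (rule mult_left_le_imp_le) simp
  qed
qed

section \<open>Sums of principal minors\<close>

text \<open>This is det(1 + x S), with the determinant taken over the polynomial ring. Compared with
  the characteristic polynomial the coefficients are reversed, so that the index p belongs to
  T_p.\<close>

definition minor_poly :: "real^'n^'n \<Rightarrow> real poly" where
  "minor_poly S = det (\<chi> i j. [:mat 1 $ i $ j, S $ i $ j:])"

text \<open>In a Leibniz term choose the entry of x S on a set X and that of the identity off X. The
  latter forces q to fix the complement, so exactly the permutations of X survive, and they sum to
  the principal minor on X.\<close>

lemma coeff_minor_poly:
  fixes S :: "real^'n^'n"
  shows "coeff (minor_poly S) k = Tsum k S"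
proof -
  have c: "coeff (of_int (sign q) * (\<Prod>i\<in>UNIV. [:mat 1 $ i $ q i, S $ i $ q i:])) k
      = (\<Sum>X\<in>{X. card X = k}. if q permutes X then of_int (sign q) * (\<Prod>i\<in>X. S $ i $ q i) else 0)"
    if q: "q permutes UNIV" for q :: "'n \<Rightarrow> 'n"
  proof -
    have split: "[:mat 1 $ i $ q i, S $ i $ q i:] = monom (S $ i $ q i) (Suc 0) + [:if q i = i then 1 else 0:]" for i
      by (auto simp: mat_def monom_altdef eq_commute)
    have A: "(\<Prod>i\<in>X. monom (S $ i $ q i) (Suc 0)) = monom (\<Prod>i\<in>X. S $ i $ q i) (card X)" for X
      by (induction X rule: infinite_finite_induct) (simp_all add: mult_monom one_pCons monom_0)
    have B: "(\<Prod>i\<in>-X. [:if q i = i then 1 else 0 :: real:]) = (if q permutes X then 1 else 0)" for X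
    proof (cases "q permutes X")
      case True
      then have "q i = i" if "i \<in> -X" for i using that by (simp add: permutes_not_in)
      then show ?thesis using True by (simp add: one_pCons[symmetric])
    next
      case False
      then obtain i where "i \<in> -X" "q i \<noteq> i"
        using q unfolding permutes_def by auto
      then have "(\<Prod>i\<in>-X. [:if q i = i then 1 else 0 :: real:]) = 0"
        by (intro prod_zero) auto
      then show ?thesis using False by simp
    qed
    have "(\<Prod>i\<in>UNIV. [:mat 1 $ i $ q i, S $ i $ q i:])
       = (\<Sum>X\<in>UNIV. monom (\<Prod>i\<in>X. S $ i $ q i) (card X) * (if q permutes X then 1 else 0))"
      unfolding split by (subst prod_add) (simp_all add: A B flip: Compl_eq_Diff_UNIV)
    also have "coeff \<dots> k = (\<Sum>X\<in>UNIV. if card X = k then (if q permutes X then \<Prod>i\<in>X. S $ i $ q i else 0) else 0)"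
      unfolding coeff_sum by (intro sum.cong) auto
    also have "\<dots> = (\<Sum>X\<in>{X. card X = k}. if q permutes X then \<Prod>i\<in>X. S $ i $ q i else 0)"
      by (subst sum.inter_filter[symmetric]) auto
    finally have e: "coeff (\<Prod>i\<in>UNIV. [:mat 1 $ i $ q i, S $ i $ q i:]) k
        = (\<Sum>X\<in>{X. card X = k}. if q permutes X then \<Prod>i\<in>X. S $ i $ q i else 0)" .
    have "of_int (sign q) = [:of_int (sign q) :: real:]" by (simp add: of_int_poly)
    then show ?thesis by (simp add: e sum_distrib_left if_distrib cong: if_cong)
  qed
  have "coeff (minor_poly S) k = (\<Sum>q | q permutes UNIV. \<Sum>X\<in>{X. card X = k}.
      if q permutes X then of_int (sign q) * (\<Prod>i\<in>X. S $ i $ q i) else 0)"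
    unfolding minor_poly_def det_def coeff_sum vec_lambda_beta
    by (intro sum.cong refl) (use c in simp)
  also have "\<dots> = (\<Sum>X\<in>{X. card X = k}. \<Sum>q | q permutes UNIV.
      if q permutes X then of_int (sign q) * (\<Prod>i\<in>X. S $ i $ q i) else 0)"
    by (rule sum.swap)
  also have "\<dots> = (\<Sum>X\<in>{X. card X = k}. principal_minor S X)"
    unfolding principal_minor_def
    by (intro sum.cong refl sum.mono_neutral_cong_right)
       (auto simp: finite_permutations intro: permutes_subset)
  finally show ?thesis by (simp add: Tsum_def)
qed

lemma poly_det: "poly (det M) x = det (\<chi> i j. poly (M $ i $ j) x)"
  for M :: "real poly^'n^'n"
proof -
  have "poly (of_int k :: real poly) x = of_int k" for k by (simp add: of_int_poly)
  then show ?thesis unfolding det_def by (simp add: poly_sum poly_prod)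
qed

lemma cpoly_det: "cpoly (det M) z = det (\<chi> i j. cpoly (M $ i $ j) z)"
  for M :: "real poly^'n^'n"
proof -
  have "cpoly (of_int k) z = of_int k" for k by (simp add: of_int_poly cpoly_pCons)
  moreover have "cpoly (sum f A) z = (\<Sum>a\<in>A. cpoly (f a) z)" for f and A :: "('n \<Rightarrow> 'n) set"
    by (induction A rule: infinite_finite_induct) (simp_all add: cpoly_add)
  moreover have "cpoly (prod f A) z = (\<Prod>a\<in>A. cpoly (f a) z)" for f and A :: "'n set"
    by (induction A rule: infinite_finite_induct) (simp_all add: cpoly_mult)
  ultimately show ?thesis unfolding det_def by (simp add: cpoly_mult)
qed

lemma poly_minor_poly: "poly (minor_poly S) x = det (mat 1 + x *\<^sub>R S)"
  unfolding minor_poly_def poly_det by (rule arg_cong[of _ _ det]) (simp add: vec_eq_iff)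

text \<open>A kernel vector \<open>v\<close> of \<open>1 + z S\<close> satisfies \<open>\<bar>v\<bar>\<^sup>2 + z \<langle>v, S v\<rangle> = 0\<close>
  with \<open>\<langle>v, S v\<rangle>\<close> real, so \<open>z\<close> is real.\<close>

lemma real_split_minor_poly:
  fixes S :: "real^'n^'n"
  assumes "transpose S = S"
  shows "real_split (minor_poly S)"
proof (rule real_split_if_roots_real)
  fix z assume z: "cpoly (minor_poly S) z = 0"
  have sym: "S $ i $ j = S $ j $ i" for i j
    using assms by (metis transpose_def vec_lambda_beta)
  define C :: "complex^'n^'n" where "C = (\<chi> i j. mat 1 $ i $ j + z * of_real (S $ i $ j))"
  have "det C = 0"
  proof -
    have "(\<chi> i j. cpoly ((\<chi> i j. [:mat 1 $ i $ j, S $ i $ j:]) $ i $ j) z) = C"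
      by (simp add: vec_eq_iff C_def cpoly_pCons mat_def)
    then show ?thesis using z unfolding minor_poly_def cpoly_det by simp
  qed
  then have "\<not> invertible C" by (simp add: invertible_det_nz)
  then obtain v where v: "C *v v = 0" "v \<noteq> 0"
    unfolding invertible_left_inverse matrix_left_invertible_ker by auto
  define N where "N = (\<Sum>i\<in>UNIV. (cmod (v $ i))\<^sup>2)"
  define B where "B = (\<Sum>i\<in>UNIV. \<Sum>j\<in>UNIV. of_real (S $ i $ j) * (cnj (v $ i) * v $ j))"
  obtain k where "v $ k \<noteq> 0" using v(2) by (auto simp: vec_eq_iff)
  then have N: "N > 0" unfolding N_def by (intro sum_pos2[of _ k]) auto
  have "cnj B = (\<Sum>i\<in>UNIV. \<Sum>j\<in>UNIV. of_real (S $ i $ j) * (cnj (v $ j) * v $ i))"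
    unfolding B_def by (simp add: mult.commute)
  also have "\<dots> = B" unfolding B_def by (subst sum.swap) (simp add: sym)
  finally have imB: "Im B = 0" by (simp add: complex_eq_iff)
  have row: "v $ i + z * (\<Sum>j\<in>UNIV. of_real (S $ i $ j) * v $ j) = 0" for i
  proof -
    have "(C *v v) $ i = (\<Sum>j\<in>UNIV. (if i = j then v $ j else 0) + z * (of_real (S $ i $ j) * v $ j))"
      unfolding matrix_vector_mult_def C_def
      by (auto simp: mat_def algebra_simps intro!: sum.cong)
    then show ?thesis using v(1) by (simp add: sum.distrib sum_distrib_left)
  qed
  have "of_real N + z * B = (\<Sum>i\<in>UNIV. cnj (v $ i) * (v $ i + z * (\<Sum>j\<in>UNIV. of_real (S $ i $ j) * v $ j)))"
    unfolding N_def B_def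
    by (simp add: sum.distrib distrib_left sum_distrib_left mult_ac complex_norm_square del: of_real_power)
  also have "\<dots> = 0" unfolding row by simp
  finally have eq: "of_real N + z * B = 0" .
  have "Re B \<noteq> 0"
  proof
    assume "Re B = 0"
    then have "B = 0" using imB by (simp add: complex_eq_iff)
    then show False using eq N by simp
  qed
  moreover have "Im z * Re B = 0" using arg_cong[OF eq, of Im] imB by simp
  ultimately show "Im z = 0" by simp
qed

lemma Tsum_newton:
  assumes "transpose S = S"
  shows "Tsum p S * Tsum (p + 2) S \<le> (Tsum (p + 1) S)\<^sup>2"
  using newton_inequality[OF real_split_minor_poly[OF assms], of p] by (simp add: coeff_minor_poly)

lemma principal_minor_empty: "principal_minor S {} = 1"
  by (simp add: principal_minor_def)

lemma Tsum_0: "Tsum 0 S = 1"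
  for S :: "real^'n^'n"
proof -
  have "{I :: 'n set. I \<subseteq> UNIV \<and> card I = 0} = {{}}" by (auto simp: card_eq_0_iff)
  then show ?thesis unfolding Tsum_def by (simp add: principal_minor_empty)
qed

lemma Tsum_scaleR: "Tsum p (c *\<^sub>R S) = c ^ p * Tsum p S"
  unfolding Tsum_def principal_minor_def
  by (auto simp: prod.distrib sum_distrib_left mult_ac intro!: sum.cong)

lemma continuous_on_Tsum [continuous_intros]:
  assumes "continuous_on X f"
  shows "continuous_on X (\<lambda>x. Tsum p (f x))"
  unfolding Tsum_def principal_minor_def by (intro continuous_intros assms)

lemma matrix_add_rdistrib: "(A + B) ** C = A ** C + B ** (C :: 'a::semiring_1^'n^'m)"
  by (simp add: vec_eq_iff matrix_matrix_mult_def sum.distrib distrib_right)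

text \<open>Single minors are not invariant, but det(1 + x S) is, for each real x, and a real
  polynomial is determined by its values.\<close>

lemma Tsum_orthogonal_conj:
  assumes "orthogonal_matrix Q"
  shows "Tsum p (transpose Q ** S ** Q) = Tsum p S"
proof -
  have Q: "transpose Q ** Q = mat 1" using assms by (simp add: orthogonal_matrix_def)
  have "poly (minor_poly (transpose Q ** S ** Q)) x = poly (minor_poly S) x" for x
  proof -
    have "mat 1 + x *\<^sub>R (transpose Q ** S ** Q) = transpose Q ** (mat 1 + x *\<^sub>R S) ** Q"
      by (simp add: matrix_add_ldistrib matrix_add_rdistrib Q matrix_scalar_ac scalar_matrix_assoc[symmetric])
    then have "det (mat 1 + x *\<^sub>R (transpose Q ** S ** Q)) = det (transpose Q ** Q) * det (mat 1 + x *\<^sub>R S)"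
      by (simp add: det_mul)
    then show ?thesis by (simp add: poly_minor_poly Q)
  qed
  then have "minor_poly (transpose Q ** S ** Q) = minor_poly S"
    by (simp add: poly_eq_poly_eq_iff[symmetric] fun_eq_iff)
  then show ?thesis by (simp flip: coeff_minor_poly)
qed

text \<open>Only row k changes and the determinant is affine in it. The slope polynomial is x times
  det(1 + x A) with row and column k deleted, which explains \<open>d 0 = 0\<close> and
  \<open>d 1 = 1\<close>.\<close>

lemma Tsum_add_diagonal_entry:
  fixes A :: "real^'n^'n" and k :: 'n
  obtains d where "d 0 = 0" "d 1 = 1"
    "\<And>\<tau> p. Tsum p (A + \<tau> *\<^sub>R (\<chi> i j. if i = k \<and> j = k then 1 else 0)) = Tsum p A + \<tau> * d p"
proof -
  define M :: "real poly^'n^'n" where "M = (\<chi> i j. [:mat 1 $ i $ j, A $ i $ j:])"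
  define D' where "D' = det (\<chi> i. if i = k then axis k 1 else M $ i)"
  define D where "D = [:0, 1:] * D'"
  have aff: "minor_poly (A + \<tau> *\<^sub>R (\<chi> i j. if i = k \<and> j = k then 1 else 0)) = minor_poly A + smult \<tau> D" for \<tau>
  proof -
    have "minor_poly (A + \<tau> *\<^sub>R (\<chi> i j. if i = k \<and> j = k then 1 else 0))
       = det (\<chi> i. if i = k then M $ i + [:0, \<tau>:] *s axis k 1 else M $ i)"
      unfolding minor_poly_def by (rule arg_cong[of _ _ det]) (auto simp: vec_eq_iff M_def axis_def)
    also have "\<dots> = det (\<chi> i. if i = k then M $ i else M $ i) + det (\<chi> i. if i = k then [:0, \<tau>:] *s axis k 1 else M $ i)"
      by (rule det_row_add)
    also have "det (\<chi> i. if i = k then [:0, \<tau>:] *s axis k 1 else M $ i) = [:0, \<tau>:] * D'"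
      unfolding D'_def by (rule det_row_mul)
    finally show ?thesis by (simp add: M_def minor_poly_def D_def)
  qed
  have "coeff D 0 = 0" by (simp add: D_def)
  moreover have "coeff D 1 = 1"
  proof -
    have "coeff D 1 = poly D' 0" by (simp add: D_def poly_0_coeff_0)
    also have "\<dots> = det (mat 1 :: real^'n^'n)"
      unfolding D'_def poly_det
      by (rule arg_cong[of _ _ det]) (auto simp: vec_eq_iff M_def axis_def mat_def)
    finally show ?thesis by simp
  qed
  ultimately show ?thesis using that[of "coeff D"] aff by (simp flip: coeff_minor_poly)
qed

section \<open>Monotonicity on the cones\<close>

text \<open>Evaluating the hypothesis near the zero of \<open>c (p + 1) + \<tau> d (p + 1)\<close> forces
  the ratio \<open>(c (p + 2) + \<tau> d (p + 2)) / (c (p + 1) + \<tau> d (p + 1))\<close> to increase.\<close>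

lemma newton_pencil_increasing:
  fixes c d :: "nat \<Rightarrow> real"
  assumes c: "\<And>p. p \<le> m \<Longrightarrow> 0 < c p" and d0: "d 0 = 0" and d1: "0 < d 1"
    and newton: "\<And>\<tau> p. (c p + \<tau> * d p) * (c (p + 2) + \<tau> * d (p + 2)) \<le> (c (p + 1) + \<tau> * d (p + 1))\<^sup>2"
    and "Suc p \<le> m"
  shows "0 \<le> d p \<and> 0 < d (Suc p) \<and> c (Suc p) * d p < c p * d (Suc p)"
  using assms(5)
proof (induction p)
  case 0
  then show ?case using c[of 0] d0 d1 by simp
next
  case (Suc p)
  define a b e where "a = d p" and "b = d (Suc p)" and "e = d (Suc (Suc p))"
  define x y z where "x = c p" and "y = c (Suc p)" and "z = c (Suc (Suc p))"
  have abW: "0 \<le> a" "0 < b" "y * a < x * b" using Suc by (auto simp: a_def b_def x_def y_def)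
  have xyz: "0 < x" "0 < y" "0 < z" using c Suc.prems by (auto simp: x_def y_def z_def)
  \<comment> \<open>W is the value of x + t a at t = - y / b, the zero of y + t b. There Newton's
    inequality has a vanishing right-hand side, so z + t e cannot be positive.\<close>
  define W where "W = (x * b - y * a) / b"
  have W: "W > 0" using abW by (simp add: W_def)
  have N: "(x + t * a) * (z + t * e) \<le> (y + t * b)\<^sup>2" for t
    using newton[of p t] by (simp add: a_def b_def e_def x_def y_def z_def)
  have "W * (z - y / b * e) \<le> 0"
    using N[of "- y / b"] abW by (simp add: W_def field_simps)
  then have "z - y / b * e \<le> 0" using W by (simp add: mult_le_0_iff)
  then have ze: "z * b \<le> y * e" using abW by (simp add: field_simps)
  have e: "e > 0"
    using ze xyz abW by (metis mult_pos_pos order_less_le_trans zero_less_mult_pos)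
  \<comment> \<open>In case of equality z + t e vanishes at the same t. After a shift by s > 0 the
    left-hand side of Newton's inequality is of first order in s and the right-hand side of second
    order; s = W e / (2 b^2) is small enough for a contradiction.\<close>
  have "z * b \<noteq> y * e"
  proof
    assume eq: "z * b = y * e"
    define s where "s = W * e / (2 * b\<^sup>2)"
    have s: "s > 0" using W e abW by (simp add: s_def)
    have t1: "x + (- y / b + s) * a = W + s * a" using abW by (simp add: W_def field_simps)
    have t2: "z + (- y / b + s) * e = s * e" using abW eq by (simp add: field_simps)
    have t3: "y + (- y / b + s) * b = s * b" using abW by (simp add: field_simps)
    have "(W + s * a) * (s * e) \<le> (s * b)\<^sup>2" using N[of "- y / b + s"] unfolding t1 t2 t3 .
    then have "s * ((W + s * a) * e) \<le> s * (s * b\<^sup>2)" by (simp add: power2_eq_square mult_ac)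
    then have "(W + s * a) * e \<le> s * b\<^sup>2" using s by simp
    moreover have "s * b\<^sup>2 = W * e / 2" using abW by (simp add: s_def)
    moreover have "0 \<le> s * a * e" using s abW e by simp
    moreover have "0 < W * e" using W e by simp
    ultimately show False by (simp add: distrib_right)
  qed
  with ze e abW show ?case by (simp add: a_def b_def e_def x_def y_def z_def mult.commute)
qed

definition psd :: "real^'n^'n \<Rightarrow> bool" where
  "psd P \<longleftrightarrow> transpose P = P \<and> (\<forall>x. 0 \<le> x \<bullet> (P *v x))"

text \<open>Membership is carried along so that each rank-one step supplies the hypothesis of the
  next one. The values T_p serve the estimate at a maximum, the quotients the one at a
  minimum.\<close>

definition Kcone_le :: "nat \<Rightarrow> real^'n^'n \<Rightarrow> real^'n^'n \<Rightarrow> bool" where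
  "Kcone_le m A B \<longleftrightarrow> A \<in> Kcone m \<and> B \<in> Kcone m \<and> (\<forall>p\<le>m. Tsum p A \<le> Tsum p B) \<and>
     (\<forall>p<m. Tsum (Suc p) A / Tsum p A \<le> Tsum (Suc p) B / Tsum p B)"

lemma Tsum_pos_Kcone: "A \<in> Kcone m \<Longrightarrow> p \<le> m \<Longrightarrow> 0 < Tsum p A"
  by (cases p) (auto simp: Kcone_def Tsum_0)

lemma Kcone_le_refl: "A \<in> Kcone m \<Longrightarrow> Kcone_le m A A"
  by (simp add: Kcone_le_def)

lemma Kcone_le_trans: "Kcone_le m A B \<Longrightarrow> Kcone_le m B C \<Longrightarrow> Kcone_le m A C"
  unfolding Kcone_le_def by (meson order_trans)

lemma transpose_add: "transpose (A + B) = transpose A + transpose (B :: 'a::plus^'n^'m)"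
  by (simp add: transpose_def vec_eq_iff)

lemma transpose_diff: "transpose (A - B) = transpose A - transpose (B :: 'a::minus^'n^'m)"
  by (simp add: transpose_def vec_eq_iff)

lemma transpose_scaleR: "transpose (c *\<^sub>R A) = c *\<^sub>R transpose (A :: real^'n^'m)"
  by (simp add: transpose_def vec_eq_iff)

text \<open>Newton's inequality holds for every symmetric matrix, hence along the whole line through
  A. The pencil lemma turns this into positive slopes and increasing quotients, starting from
  membership of A alone.\<close>

lemma Kcone_le_diagonal_entry:
  fixes A :: "real^'n^'n"
  assumes A: "A \<in> Kcone m" and s: "0 \<le> s"
  shows "Kcone_le m A (A + s *\<^sub>R (\<chi> i j. if i = k \<and> j = k then 1 else 0))"
proof -
  define E :: "real^'n^'n" where "E = (\<chi> i j. if i = k \<and> j = k then 1 else 0)"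
  have symA: "transpose A = A" using A by (simp add: Kcone_def)
  have "transpose E = E" by (auto simp: E_def transpose_def vec_eq_iff)
  then have sym: "transpose (A + t *\<^sub>R E) = A + t *\<^sub>R E" for t
    by (simp add: transpose_add transpose_scaleR symA)
  obtain d where d: "d 0 = 0" "d 1 = 1" "\<And>\<tau> p. Tsum p (A + \<tau> *\<^sub>R E) = Tsum p A + \<tau> * d p"
    unfolding E_def by (rule Tsum_add_diagonal_entry[of A k]) blast
  have cp: "0 < Tsum p A" if "p \<le> m" for p using Tsum_pos_Kcone[OF A that] .
  have inc: "0 \<le> d p \<and> 0 < d (Suc p) \<and> Tsum (Suc p) A * d p < Tsum p A * d (Suc p)" if "Suc p \<le> m" for p
  proof (rule newton_pencil_increasing[where m = m and c = "\<lambda>p. Tsum p A"])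
    show "(Tsum p A + \<tau> * d p) * (Tsum (p + 2) A + \<tau> * d (p + 2)) \<le> (Tsum (p + 1) A + \<tau> * d (p + 1))\<^sup>2"
      for \<tau> p
      using Tsum_newton[OF sym, of p \<tau>] by (simp only: d(3))
  qed (use cp d(1,2) that in simp_all)
  have dp: "0 \<le> d p" if "p \<le> m" for p
    using inc[of "p - 1"] that d(1) by (cases p) auto
  have le: "Tsum p A \<le> Tsum p (A + s *\<^sub>R E)" if "p \<le> m" for p
    using dp[OF that] s by (simp add: d(3))
  have "A + s *\<^sub>R E \<in> Kcone m"
    unfolding Kcone_def
  proof (safe intro!: sym)
    fix p assume "p \<in> {1..m}"
    then show "0 < Tsum p (A + s *\<^sub>R E)" using less_le_trans[OF cp le, of p] by simp
  qed
  moreover have "Tsum (Suc p) A / Tsum p A \<le> Tsum (Suc p) (A + s *\<^sub>R E) / Tsum p (A + s *\<^sub>R E)"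
    if "p < m" for p
  proof -
    have "0 < Tsum p A" "0 < Tsum p (A + s *\<^sub>R E)" using cp[of p] le[of p] that by auto
    \<comment> \<open>After cancellation this is s times the strict inequality between the cross
      products in \<open>inc\<close>.\<close>
    moreover have "Tsum (Suc p) A * Tsum p (A + s *\<^sub>R E) \<le> Tsum (Suc p) (A + s *\<^sub>R E) * Tsum p A"
      using mult_left_mono[OF less_imp_le s, of "Tsum (Suc p) A * d p" "Tsum p A * d (Suc p)"] inc[of p] that
      by (simp add: d(3) algebra_simps)
    ultimately show ?thesis by (simp add: divide_simps)
  qed
  ultimately show ?thesis using A le unfolding Kcone_le_def E_def by blast
qed

text \<open>An orthogonal Q taking a basis vector to the direction of x turns x x^T into
  \<bar>x\<bar>^2 times a diagonal unit, and no T_p notices the change of basis.\<close>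

lemma Kcone_le_rank_one:
  fixes A :: "real^'n^'n"
  assumes A: "A \<in> Kcone m"
  shows "Kcone_le m A (A + (\<chi> i j. x $ i * x $ j))"
proof (cases "x = 0")
  case True
  then have "(\<chi> i j. x $ i * x $ j) = 0" by (simp add: vec_eq_iff)
  then show ?thesis using A by (simp add: Kcone_le_refl)
next
  case False
  \<comment> \<open>Any coordinate serves as the target of the rotation.\<close>
  obtain k :: 'n where True by simp
  define X where "X = (\<chi> i j. x $ i * x $ j)"
  define E :: "real^'n^'n" where "E = (\<chi> i j. if i = k \<and> j = k then 1 else 0)"
  have "norm (x /\<^sub>R norm x) = 1" using False by simp
  then obtain Q where Q: "orthogonal_matrix Q" "Q *v axis k 1 = x /\<^sub>R norm x"
    by (rule orthogonal_matrix_exists_basis)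
  have Qt: "transpose Q ** Q = mat 1" using Q by (simp add: orthogonal_matrix_def)
  have "transpose Q *v x = norm x *\<^sub>R (transpose Q *v (Q *v axis k 1))"
    unfolding Q(2) using False by (simp add: matrix_vector_mult_scaleR)
  also have "\<dots> = norm x *\<^sub>R axis k 1"
    by (simp add: matrix_vector_mul_assoc Qt)
  finally have Qx: "transpose Q *v x = norm x *\<^sub>R axis k 1" .
  have "transpose Q ** X ** Q = (\<chi> i j. (transpose Q *v x) $ i * (transpose Q *v x) $ j)"
  proof (simp only: vec_eq_iff vec_lambda_beta, intro allI)
    fix i j
    have "(transpose Q ** X ** Q) $ i $ j = (\<Sum>k\<in>UNIV. \<Sum>l\<in>UNIV. Q $ l $ i * x $ l * (Q $ k $ j * x $ k))"
      by (simp add: matrix_matrix_mult_def transpose_def X_def sum_distrib_right sum_distrib_left mult_ac)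
    also have "\<dots> = (transpose Q *v x) $ i * (transpose Q *v x) $ j"
      by (subst sum.swap) (simp add: matrix_vector_mult_def transpose_def sum_product)
    finally show "(transpose Q ** X ** Q) $ i $ j = (transpose Q *v x) $ i * (transpose Q *v x) $ j" .
  qed
  also have "\<dots> = (norm x)\<^sup>2 *\<^sub>R E"
    unfolding Qx by (auto simp: vec_eq_iff E_def axis_def power2_eq_square)
  finally have QXQ: "transpose Q ** X ** Q = (norm x)\<^sup>2 *\<^sub>R E" .
  define A' where "A' = transpose Q ** A ** Q"
  have T: "Tsum p A' = Tsum p A" for p
    unfolding A'_def by (rule Tsum_orthogonal_conj[OF Q(1)])
  have TX: "Tsum p (A' + (norm x)\<^sup>2 *\<^sub>R E) = Tsum p (A + X)" for p
  proof -
    have "A' + (norm x)\<^sup>2 *\<^sub>R E = transpose Q ** (A + X) ** Q"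
      by (simp add: A'_def matrix_add_ldistrib matrix_add_rdistrib QXQ)
    then show ?thesis by (simp add: Tsum_orthogonal_conj[OF Q(1)])
  qed
  have symA: "transpose A = A" using A by (simp add: Kcone_def)
  have "transpose A' = A'" unfolding A'_def by (simp add: matrix_transpose_mul symA matrix_mul_assoc)
  then have A': "A' \<in> Kcone m" using A T by (simp add: Kcone_def)
  have "transpose (A + X) = A + X" using symA by (simp add: transpose_add) (simp add: X_def transpose_def mult.commute)
  then show ?thesis
    using Kcone_le_diagonal_entry[OF A', of "(norm x)\<^sup>2" k] A
    by (simp add: Kcone_le_def T TX Kcone_def flip: E_def X_def)
qed

text \<open>Cholesky elimination writes a positive semidefinite matrix as a sum of
  rank-one matrices, killing one row in each step.\<close>

lemma Kcone_le_add_psd: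
  fixes A P :: "real^'n^'n"
  assumes "A \<in> Kcone m" "psd P"
  shows "Kcone_le m A (A + P)"
  using assms
proof (induction "card {i. P $ i \<noteq> 0}" arbitrary: A P rule: less_induct)
  case less
  show ?case
  proof (cases "P = 0")
    case True
    then show ?thesis using less.prems by (simp add: Kcone_le_refl)
  next
    case False
    then obtain i where i: "P $ i \<noteq> 0" by (auto simp: vec_eq_iff)
    have sym: "P $ j $ k = P $ k $ j" for j k
      using less.prems(2) unfolding psd_def by (metis transpose_def vec_lambda_beta)
    have selfadj: "y \<bullet> (P *v x) = x \<bullet> (P *v y)" for x y
    proof -
      have "y \<bullet> (P *v x) = (y v* P) \<bullet> x" by (simp add: dot_lmul_matrix)
      also have "y v* P = P *v y"
        using less.prems(2) unfolding psd_def by (metis transpose_matrix_vector)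
      finally show ?thesis by (simp add: inner_commute)
    qed
    define r where "r = P *v axis i 1"
    have r: "r $ j = P $ i $ j" for j by (simp add: r_def matrix_vector_mult_basis column_def sym[of j i])
    \<comment> \<open>The form along x + s e_i, quadratic in s, is behind everything that follows:
      the sign of the pivot, the vanishing of the row when the pivot is 0, and the Schur
      complement.\<close>
    have quad: "0 \<le> x \<bullet> (P *v x) + 2 * s * (x \<bullet> r) + s\<^sup>2 * P $ i $ i" for x s
    proof -
      have "0 \<le> (x + s *\<^sub>R axis i 1) \<bullet> (P *v (x + s *\<^sub>R axis i 1))"
        using less.prems(2) by (simp add: psd_def)
      also have "\<dots> = x \<bullet> (P *v x) + 2 * s * (x \<bullet> r) + s\<^sup>2 * (axis i 1 \<bullet> r)"
        by (simp add: matrix_vector_right_distrib matrix_vector_mult_scaleR inner_add selfadj[of "axis i 1" x]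
            power2_eq_square algebra_simps flip: r_def)
      finally show ?thesis by (simp add: inner_axis' r)
    qed
    have "P $ i $ i \<noteq> 0"
    proof
      assume 0: "P $ i $ i = 0"
      obtain j where j: "P $ i $ j \<noteq> 0" using i by (auto simp: vec_eq_iff)
      define a where "a = axis j 1 \<bullet> (P *v axis j 1)"
      have "0 \<le> a + 2 * s * P $ i $ j" for s
        using quad[of "axis j 1" s] 0 by (simp add: a_def inner_axis' r)
      \<comment> \<open>With a zero pivot the form is affine in s; this s gives it the value
        -1.\<close>
      from this[of "- (a + 1) / (2 * P $ i $ j)"] show False
        using j by (simp add: field_simps)
    qed
    moreover have "0 \<le> P $ i $ i" using quad[of 0 1] by simp
    ultimately have Pii: "0 < P $ i $ i" by simp
    \<comment> \<open>Scaled so that x x^T has the same i-th row as P.\<close>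
    define x where "x = r /\<^sub>R sqrt (P $ i $ i)"
    define X where "X = (\<chi> i j. x $ i * x $ j)"
    define P' where "P' = P - X"
    have X: "X $ j $ k = P $ i $ j * P $ i $ k / P $ i $ i" for j k
      using Pii by (simp add: X_def x_def r field_simps)
    have "psd P'"
      unfolding psd_def
    proof (intro conjI allI)
      have "transpose X = X" by (simp add: X_def transpose_def mult.commute)
      then show "transpose P' = P'" using less.prems(2) by (simp add: P'_def transpose_diff psd_def)
      fix y
      have "y \<bullet> (X *v y) = (y \<bullet> x)\<^sup>2"
        by (simp add: inner_vec_def matrix_vector_mult_def X_def sum_product power2_eq_square sum_distrib_left mult_ac)
      also have "\<dots> = (y \<bullet> r)\<^sup>2 / P $ i $ i"
      proof -
        have "y \<bullet> x = (y \<bullet> r) / sqrt (P $ i $ i)" by (simp add: x_def divide_inverse mult.commute)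
        then show ?thesis using Pii by (simp add: power_divide)
      qed
      finally have yX: "y \<bullet> (X *v y) = (y \<bullet> r)\<^sup>2 / P $ i $ i" .
      show "0 \<le> y \<bullet> (P' *v y)"
        \<comment> \<open>This s minimizes the quadratic, and the minimum is the form of the Schur
          complement.\<close>
        using quad[of y "- (y \<bullet> r) / P $ i $ i"] Pii
        by (simp add: P'_def matrix_vector_mult_diff_rdistrib inner_diff_right yX power2_eq_square)
    qed
    \<comment> \<open>Row i is cleared, and by symmetry a zero row j has P_ij = 0 and stays
      zero.\<close>
    moreover have "card {j. P' $ j \<noteq> 0} < card {j. P $ j \<noteq> 0}"
    proof (rule psubset_card_mono)
      have "P' $ j = 0" if "P $ j = 0" for j
      proof -
        have "P $ i $ j = 0" using that by (subst sym) simp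
        then show ?thesis using that by (simp add: vec_eq_iff P'_def X)
      qed
      moreover have "P' $ i = 0" using Pii by (simp add: vec_eq_iff P'_def X)
      ultimately show "{j. P' $ j \<noteq> 0} \<subset> {j. P $ j \<noteq> 0}" using i by blast
    qed simp
    moreover have AX: "Kcone_le m A (A + X)"
      unfolding X_def by (rule Kcone_le_rank_one[OF less.prems(1)])
    ultimately have "Kcone_le m (A + X) (A + X + P')"
      using less.hyps[of P' "A + X"] by (simp add: Kcone_le_def)
    then show ?thesis using Kcone_le_trans[OF AX] by (simp add: P'_def)
  qed
qed

text \<open>The chain T_m^(1/m) \<le> T_p^(1/p) written without roots. Its purpose is to pass from
  the vanishing of one T to another in a limit, for which the usual binomial constants are
  irrelevant.\<close>

lemma Tsum_maclaurin:
  assumes A: "A \<in> Kcone m" and "p \<le> m"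
  shows "Tsum m A ^ p \<le> Tsum p A ^ m"
proof -
  have sym: "transpose A = A" using A by (simp add: Kcone_def)
  define c where "c p = Tsum p A" for p
  have c: "0 < c p" if "p \<le> m" for p using Tsum_pos_Kcone[OF A that] by (simp add: c_def)
  have step: "c (Suc p) ^ p \<le> c p ^ Suc p" if "Suc p \<le> m" for p
    using that
  proof (induction p)
    case 0
    then show ?case by (simp add: c_def Tsum_0)
  next
    case (Suc p)
    have pos: "0 < c p" "0 < c (Suc p)" "0 < c (Suc (Suc p))" using c Suc.prems by auto
    have "c p * c (Suc (Suc p)) \<le> (c (Suc p))\<^sup>2"
      using Tsum_newton[OF sym, of p] by (simp add: c_def)
    \<comment> \<open>The power p + 1 of Newton's inequality lets the induction hypothesis bound c
      (p + 1)^p, after which c p ^ (p + 1) cancels.\<close>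
    then have "(c p * c (Suc (Suc p))) ^ Suc p \<le> ((c (Suc p))\<^sup>2) ^ Suc p"
      using pos by (intro power_mono) auto
    then have "c p ^ Suc p * c (Suc (Suc p)) ^ Suc p \<le> c (Suc p) ^ p * c (Suc p) ^ Suc (Suc p)"
      by (simp add: power_mult_distrib power2_eq_square mult_ac)
    also have "\<dots> \<le> c p ^ Suc p * c (Suc p) ^ Suc (Suc p)"
      using Suc pos by (intro mult_right_mono) auto
    finally show ?case using pos by (simp del: power_Suc)
  qed
  have "c q ^ p \<le> c p ^ q" if "p \<le> q" "q \<le> m" for q
    using that
  proof (induction q rule: dec_induct)
    case base
    then show ?case by simp
  next
    case (step q)
    show ?case
    proof (cases "p = 0 \<or> q = 0")
      case True
      then show ?thesis using step by (auto simp: c_def Tsum_0)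
    next
      case False
      have pos: "0 < c p" "0 < c q" "0 < c (Suc q)" using c step by auto
      \<comment> \<open>Raising to the power q makes the step from q to q + 1 composable with the
        induction hypothesis; the power is removed at the end.\<close>
      have "(c (Suc q) ^ p) ^ q = (c (Suc q) ^ q) ^ p" by (simp flip: power_mult add: mult.commute)
      also have "\<dots> \<le> (c q ^ Suc q) ^ p"
        using \<open>\<And>p. Suc p \<le> m \<Longrightarrow> c (Suc p) ^ p \<le> c p ^ Suc p\<close>[of q] step pos
        by (intro power_mono) auto
      also have "\<dots> = (c q ^ p) ^ Suc q" by (simp only: power_mult[symmetric] mult.commute)
      also have "\<dots> \<le> (c p ^ q) ^ Suc q" using step pos by (intro power_mono) auto
      also have "\<dots> = (c p ^ Suc q) ^ q" by (simp only: power_mult[symmetric] mult.commute)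
      finally show ?thesis using power_le_imp_le_base[of "c (Suc q) ^ p" "q - 1" "c p ^ Suc q"] False pos by simp
    qed
  qed
  then show ?thesis using assms(2) by (simp add: c_def)
qed

section \<open>Second derivatives\<close>

lemma pd_exists_has_derivative:
  assumes "pd_exists i f (x + s *\<^sub>R axis i 1)"
  shows "((\<lambda>s. f (x + s *\<^sub>R axis i 1)) has_real_derivative pd i f (x + s *\<^sub>R axis i 1)) (at s)"
proof -
  have "((\<lambda>h. f (x + s *\<^sub>R axis i 1 + h *\<^sub>R axis i 1)) has_real_derivative pd i f (x + s *\<^sub>R axis i 1)) (at 0)"
    using assms unfolding pd_exists_def pd_def has_real_derivative_iff_has_vector_derivative
    by (simp add: vector_derivative_works)
  then have "((\<lambda>h. f (x + (h + s) *\<^sub>R axis i 1)) has_real_derivative pd i f (x + s *\<^sub>R axis i 1)) (at 0)"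
    by (simp add: algebra_simps)
  then show ?thesis by (simp add: DERIV_shift[of _ _ 0 s, simplified])
qed

text \<open>Move one coordinate at a time: the induction is over the set J of coordinates already
  moved, and the mean value theorem in direction i adds an error of e / 2.\<close>

lemma has_derivative_continuous_pd:
  fixes f :: "real^'n \<Rightarrow> real"
  assumes U: "open U" "x \<in> U"
    and ex: "\<And>i y. y \<in> U \<Longrightarrow> pd_exists i f y"
    and cont: "\<And>i. continuous_on U (pd i f)"
  shows "(f has_derivative (\<lambda>h. \<Sum>i\<in>UNIV. h $ i * pd i f x)) (at x)"
proof -
  define proj :: "'n set \<Rightarrow> real^'n \<Rightarrow> real^'n" where "proj J h = (\<chi> i. if i \<in> J then h $ i else 0)" for J h
  have norm_proj: "norm (proj J h) \<le> norm h" for J h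
    unfolding proj_def by (intro norm_le_componentwise_cart) auto
  have "\<exists>d>0. \<forall>h. norm h < d \<longrightarrow> \<bar>f (x + proj J h) - f x - (\<Sum>i\<in>J. h $ i * pd i f x)\<bar> \<le> e * norm h"
    if "finite J" "e > 0" for J e
    using that
  proof (induction J arbitrary: e rule: finite_induct)
    case empty
    have "proj {} h = 0" for h by (simp add: proj_def vec_eq_iff)
    with empty show ?case by (intro exI[of _ 1]) simp
  next
    case (insert i J)
    obtain d1 where d1: "d1 > 0"
      "\<And>h. norm h < d1 \<Longrightarrow> \<bar>f (x + proj J h) - f x - (\<Sum>i\<in>J. h $ i * pd i f x)\<bar> \<le> e / 2 * norm h"
      using insert.IH[of "e / 2"] insert.prems by auto
    obtain r where r: "r > 0" "ball x r \<subseteq> U" using U open_contains_ball by blast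
    have "isCont (pd i f) x" using cont U by (simp add: continuous_on_eq_continuous_at)
    then obtain d2 where d2: "d2 > 0" "\<And>y. dist y x < d2 \<Longrightarrow> dist (pd i f y) (pd i f x) < e / 2"
      unfolding continuous_at_eps_delta using insert.prems by (meson half_gt_zero)
    \<comment> \<open>The segment in direction i starts at x + \<open>proj J h\<close> and is at
      most \<bar>h\<bar> long, so its points are within 2 \<bar>h\<bar> of x; hence the
      halves.\<close>
    define d where "d = Min {d1, r / 2, d2 / 2}"
    have d: "d > 0" "d \<le> d1" "2 * d \<le> r" "2 * d \<le> d2" using d1(1) r(1) d2(1) by (auto simp: d_def)
    have "\<bar>f (x + proj (insert i J) h) - f x - (\<Sum>i\<in>insert i J. h $ i * pd i f x)\<bar> \<le> e * norm h"
      if h: "norm h < d" for h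
    proof -
      define y where "y = x + proj J h"
      define a where "a = h $ i"
      have ins: "x + proj (insert i J) h = y + a *\<^sub>R axis i 1"
        using insert.hyps by (auto simp: y_def proj_def vec_eq_iff axis_def a_def)
      have a: "\<bar>a\<bar> \<le> norm h" unfolding a_def by (rule component_le_norm_cart)
      have near: "dist (y + s *\<^sub>R axis i 1) x < 2 * d" if "\<bar>s\<bar> \<le> \<bar>a\<bar>" for s
      proof -
        have "norm (proj J h + s *\<^sub>R axis i 1) \<le> norm h + \<bar>s\<bar>"
          using norm_triangle_ineq[of "proj J h" "s *\<^sub>R axis i 1"] norm_proj[of J h] by simp
        then show ?thesis using that a h by (simp add: y_def dist_norm add.assoc)
      qed
      have "norm ((f (y + a *\<^sub>R axis i 1) - a * pd i f x) - (f (y + 0 *\<^sub>R axis i 1) - 0 * pd i f x)) \<le> e / 2 * norm (a - 0)"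
      proof (rule field_differentiable_bound[where S = "{s. \<bar>s\<bar> \<le> \<bar>a\<bar>}" and f' = "\<lambda>s. pd i f (y + s *\<^sub>R axis i 1) - pd i f x"])
        have "{s. \<bar>s\<bar> \<le> \<bar>a\<bar>} = cball 0 \<bar>a\<bar>" by auto
        then show "convex {s. \<bar>s\<bar> \<le> \<bar>a\<bar>}" by simp
        fix s assume s: "s \<in> {s. \<bar>s\<bar> \<le> \<bar>a\<bar>}"
        have nr: "dist (y + s *\<^sub>R axis i 1) x < 2 * d" using near[of s] s by simp
        then have "y + s *\<^sub>R axis i 1 \<in> U" using r(2) d by (auto simp: dist_commute)
        note D = pd_exists_has_derivative[OF ex[OF this]]
        show "((\<lambda>s. f (y + s *\<^sub>R axis i 1) - s * pd i f x) has_real_derivative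
            pd i f (y + s *\<^sub>R axis i 1) - pd i f x) (at s within {s. \<bar>s\<bar> \<le> \<bar>a\<bar>})"
          by (rule has_field_derivative_at_within) (auto intro!: derivative_eq_intros D)
        have "dist (pd i f (y + s *\<^sub>R axis i 1)) (pd i f x) < e / 2" using nr d by (intro d2) simp
        then show "norm (pd i f (y + s *\<^sub>R axis i 1) - pd i f x) \<le> e / 2" by (simp add: dist_norm)
      qed auto
      also have "e / 2 * norm (a - 0) \<le> e / 2 * norm h"
        using insert.prems a by (intro mult_left_mono) auto
      finally have "\<bar>f (y + a *\<^sub>R axis i 1) - f y - a * pd i f x\<bar> \<le> e / 2 * norm h"
        by (simp add: abs_le_iff algebra_simps)
      moreover have "\<bar>f y - f x - (\<Sum>i\<in>J. h $ i * pd i f x)\<bar> \<le> e / 2 * norm h"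
        unfolding y_def using d1(2)[of h] h d by simp
      ultimately show ?thesis
        unfolding ins sum.insert[OF insert.hyps] a_def by linarith
    qed
    then show ?case using d(1) by blast
  qed
  from this[of UNIV] have lim: "\<exists>d>0. \<forall>h. norm h < d \<longrightarrow> \<bar>f (x + h) - f x - (\<Sum>i\<in>UNIV. h $ i * pd i f x)\<bar> \<le> e * norm h"
    if "e > 0" for e using that by (simp add: proj_def)
  have lin: "bounded_linear (\<lambda>h. \<Sum>i\<in>UNIV. h $ i * pd i f x)"
    by (intro bounded_linear_sum bounded_linear_mult_left[THEN bounded_linear_compose] bounded_linear_vec_nth)
  show ?thesis
    unfolding has_derivative_at_alt
  proof (intro conjI allI impI lin)
    fix e :: real assume "e > 0"
    from lim[OF this] obtain d where d: "d > 0"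
      "\<And>h. norm h < d \<Longrightarrow> \<bar>f (x + h) - f x - (\<Sum>i\<in>UNIV. h $ i * pd i f x)\<bar> \<le> e * norm h" by blast
    show "\<exists>d>0. \<forall>y. norm (y - x) < d \<longrightarrow>
        norm (f y - f x - (\<Sum>i\<in>UNIV. (y - x) $ i * pd i f x)) \<le> e * norm (y - x)"
      using d(1) d(2)[of "y - x" for y] by (auto intro!: exI[of _ d])
  qed
qed

lemma C2_on_line_derivatives:
  fixes f :: "real^'n \<Rightarrow> real"
  assumes U: "open U" "x \<in> U" and f: "C2_on U f"
  obtains r g where "r > 0" "ball x r \<subseteq> U"
    "\<And>s. x + s *\<^sub>R \<xi> \<in> ball x r \<Longrightarrow> ((\<lambda>s. f (x + s *\<^sub>R \<xi>)) has_real_derivative g s) (at s)"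
    "(g has_real_derivative \<xi> \<bullet> (hess f x *v \<xi>)) (at 0)"
proof -
  obtain r where r: "r > 0" "ball x r \<subseteq> U" using U open_contains_ball by blast
  have chain: "((\<lambda>s. F (x + s *\<^sub>R \<xi>)) has_real_derivative (\<Sum>i\<in>UNIV. \<xi> $ i * pd i F (x + s *\<^sub>R \<xi>))) (at s)"
    if "x + s *\<^sub>R \<xi> \<in> U" "\<And>i y. y \<in> U \<Longrightarrow> pd_exists i F y" "\<And>i. continuous_on U (pd i F)" for F s
  proof -
    have "((\<lambda>s. F (x + s *\<^sub>R \<xi>)) has_derivative (\<lambda>h. \<Sum>i\<in>UNIV. (h *\<^sub>R \<xi>) $ i * pd i F (x + s *\<^sub>R \<xi>))) (at s)"
      by (rule has_derivative_compose[where g = F and f = "\<lambda>s. x + s *\<^sub>R \<xi>", OF _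
            has_derivative_continuous_pd[OF U(1) that(1)]])
         (use that(2,3) in \<open>auto intro!: derivative_eq_intros\<close>)
    then show ?thesis
      unfolding has_field_derivative_def
      by (rule has_derivative_eq_rhs) (simp add: fun_eq_iff sum_distrib_left mult_ac)
  qed
  define g where "g s = (\<Sum>i\<in>UNIV. \<xi> $ i * pd i f (x + s *\<^sub>R \<xi>))" for s
  show ?thesis
  proof (rule that[of r g])
    show "((\<lambda>s. f (x + s *\<^sub>R \<xi>)) has_real_derivative g s) (at s)" if "x + s *\<^sub>R \<xi> \<in> ball x r" for s
      unfolding g_def using that r f by (intro chain) (auto simp: C2_on_def)
    have "((\<lambda>s. pd i f (x + s *\<^sub>R \<xi>)) has_real_derivative (\<Sum>j\<in>UNIV. \<xi> $ j * pd j (pd i f) x)) (at 0)" for i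
      using chain[of 0 "pd i f"] U f by (auto simp: C2_on_def)
    then have "(g has_real_derivative (\<Sum>i\<in>UNIV. \<xi> $ i * (\<Sum>j\<in>UNIV. \<xi> $ j * pd j (pd i f) x))) (at 0)"
      unfolding g_def by (intro DERIV_sum DERIV_cmult)
    also have "(\<Sum>i\<in>UNIV. \<xi> $ i * (\<Sum>j\<in>UNIV. \<xi> $ j * pd j (pd i f) x)) = \<xi> \<bullet> (hess f x *v \<xi>)"
      unfolding sum_distrib_left
      by (subst sum.swap) (simp add: inner_vec_def matrix_vector_mult_def hess_def sum_distrib_left mult_ac)
    finally show "(g has_real_derivative \<xi> \<bullet> (hess f x *v \<xi>)) (at 0)" .
  qed (use r in auto)
qed

text \<open>If D > 0 then g' > 0 just to the right of the critical point 0, and g would rise there.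
  Differentiability of g' at 0 is enough for this.\<close>

lemma second_derivative_nonpos_at_max:
  fixes g g' :: "real \<Rightarrow> real"
  assumes r: "r > 0" and d: "\<And>s. \<bar>s\<bar> < r \<Longrightarrow> (g has_real_derivative g' s) (at s)"
    and dd: "(g' has_real_derivative D) (at 0)" and max: "\<And>s. \<bar>s\<bar> < r \<Longrightarrow> g s \<le> g 0"
  shows "D \<le> 0"
proof (rule ccontr)
  assume "\<not> D \<le> 0"
  then obtain e where e: "e > 0" "\<And>h. 0 < h \<Longrightarrow> h < e \<Longrightarrow> g' 0 < g' (0 + h)"
    using DERIV_pos_inc_right[OF dd] by auto
  have g0: "g' 0 = 0"
    by (rule DERIV_local_max[OF d[of 0] r]) (use r max in auto)
  define s where "s = min e r / 2"
  have s: "0 < s" "s < e" "s < r" using e(1) r by (auto simp: s_def)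
  obtain z where z: "0 < z" "z < s" "g s - g 0 = (s - 0) * g' z"
    using MVT2[of 0 s g g'] s d by auto
  then have "g s - g 0 > 0" using e(2)[of z] g0 s by simp
  then show False using max[of s] s by simp
qed

lemma hess_difference_nonpos_at_max:
  fixes f h :: "real^'n \<Rightarrow> real"
  assumes U: "open U" "x \<in> U" and f: "C2_on U f" and h: "C2_on U h"
    and max: "\<And>y. y \<in> U \<Longrightarrow> a * f y - c * h y \<le> a * f x - c * h x"
  shows "\<xi> \<bullet> ((a *\<^sub>R hess f x - c *\<^sub>R hess h x) *v \<xi>) \<le> 0"
proof -
  obtain r1 g1 where 1: "r1 > 0" "ball x r1 \<subseteq> U"
    "\<And>s. x + s *\<^sub>R \<xi> \<in> ball x r1 \<Longrightarrow> ((\<lambda>s. f (x + s *\<^sub>R \<xi>)) has_real_derivative g1 s) (at s)"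
    "(g1 has_real_derivative \<xi> \<bullet> (hess f x *v \<xi>)) (at 0)"
    by (rule C2_on_line_derivatives[OF U f, of \<xi>]) blast
  obtain r2 g2 where 2: "r2 > 0" "ball x r2 \<subseteq> U"
    "\<And>s. x + s *\<^sub>R \<xi> \<in> ball x r2 \<Longrightarrow> ((\<lambda>s. h (x + s *\<^sub>R \<xi>)) has_real_derivative g2 s) (at s)"
    "(g2 has_real_derivative \<xi> \<bullet> (hess h x *v \<xi>)) (at 0)"
    by (rule C2_on_line_derivatives[OF U h, of \<xi>]) blast
  \<comment> \<open>The added 1 covers \<xi> = 0.\<close>
  define r where "r = min r1 r2 / (norm \<xi> + 1)"
  have r: "r > 0" using 1(1) 2(1) by (simp add: r_def add_nonneg_pos)
  have in_ball: "x + s *\<^sub>R \<xi> \<in> ball x r1 \<inter> ball x r2" if "\<bar>s\<bar> < r" for s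
  proof -
    have "\<bar>s\<bar> * norm \<xi> \<le> \<bar>s\<bar> * (norm \<xi> + 1)" by (intro mult_left_mono) auto
    also have "\<dots> < min r1 r2" using that by (simp add: r_def pos_less_divide_eq add_nonneg_pos)
    finally show ?thesis by (simp add: dist_norm)
  qed
  have "a * (\<xi> \<bullet> (hess f x *v \<xi>)) - c * (\<xi> \<bullet> (hess h x *v \<xi>)) \<le> 0"
  proof (rule second_derivative_nonpos_at_max[OF r])
    show "((\<lambda>s. a * f (x + s *\<^sub>R \<xi>) - c * h (x + s *\<^sub>R \<xi>)) has_real_derivative a * g1 s - c * g2 s) (at s)"
      if "\<bar>s\<bar> < r" for s
      using 1(3) 2(3) in_ball[OF that] by (intro DERIV_diff DERIV_cmult) auto
    show "((\<lambda>s. a * g1 s - c * g2 s) has_real_derivative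
        a * (\<xi> \<bullet> (hess f x *v \<xi>)) - c * (\<xi> \<bullet> (hess h x *v \<xi>))) (at 0)"
      using 1(4) 2(4) by (intro DERIV_diff DERIV_cmult)
    show "a * f (x + s *\<^sub>R \<xi>) - c * h (x + s *\<^sub>R \<xi>) \<le> a * f (x + 0 *\<^sub>R \<xi>) - c * h (x + 0 *\<^sub>R \<xi>)"
      if "\<bar>s\<bar> < r" for s
      using max[of "x + s *\<^sub>R \<xi>"] in_ball[OF that] 1(2) by auto
  qed
  then show ?thesis
    by (simp add: matrix_vector_mult_diff_rdistrib inner_diff_right scaleR_matrix_vector_assoc[symmetric])
qed

text \<open>The second difference is symmetric in i and j while the right-hand side is not: using it
  in both orders proves Schwarz's theorem. The radius 3 h strictly contains the parallelogram, whose
  points are within 2 h of x.\<close>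

lemma mixed_difference_mean_value:
  fixes f :: "real^'n \<Rightarrow> real"
  assumes ball: "ball x (3 * h) \<subseteq> U" and h: "h > 0" and f: "C2_on U f"
  obtains y where "dist y x < 3 * h"
    "f (x + h *\<^sub>R axis i 1 + h *\<^sub>R axis j 1) - f (x + h *\<^sub>R axis i 1) - f (x + h *\<^sub>R axis j 1) + f x
      = h\<^sup>2 * pd j (pd i f) y"
proof -
  have near: "dist (x + s *\<^sub>R axis i 1 + t *\<^sub>R axis j 1) x < 3 * h"
    if "0 \<le> s" "s \<le> h" "0 \<le> t" "t \<le> h" for s t
  proof -
    have "norm (s *\<^sub>R axis i 1 + t *\<^sub>R axis j 1 :: real^'n) \<le> s + t"
      using norm_triangle_ineq[of "s *\<^sub>R axis i 1 :: real^'n" "t *\<^sub>R axis j 1"] that by simp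
    then show ?thesis using that h by (simp add: dist_norm add.assoc)
  qed
  have in_U: "x + s *\<^sub>R axis i 1 + t *\<^sub>R axis j 1 \<in> U"
    if "0 \<le> s" "s \<le> h" "0 \<le> t" "t \<le> h" for s t
    using near[OF that] ball by (auto simp: dist_commute)
  define \<phi> where "\<phi> s = f (x + h *\<^sub>R axis j 1 + s *\<^sub>R axis i 1) - f (x + s *\<^sub>R axis i 1)" for s
  define \<phi>' where "\<phi>' s = pd i f (x + h *\<^sub>R axis j 1 + s *\<^sub>R axis i 1) - pd i f (x + s *\<^sub>R axis i 1)" for s
  have "(\<phi> has_real_derivative \<phi>' s) (at s)" if "0 \<le> s" "s \<le> h" for s
    unfolding \<phi>_def \<phi>'_def
  proof (intro DERIV_diff pd_exists_has_derivative)
    have "x + h *\<^sub>R axis j 1 + s *\<^sub>R axis i 1 \<in> U" "x + s *\<^sub>R axis i 1 \<in> U"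
      using in_U[OF that, of h] in_U[OF that, of 0] h by (simp_all add: add_ac)
    with f show "pd_exists i f (x + h *\<^sub>R axis j 1 + s *\<^sub>R axis i 1)" "pd_exists i f (x + s *\<^sub>R axis i 1)"
      by (simp_all add: C2_on_def)
  qed
  from MVT2[OF h this] obtain \<theta> where \<theta>: "0 < \<theta>" "\<theta> < h" "\<phi> h - \<phi> 0 = (h - 0) * \<phi>' \<theta>"
    by blast
  have "((\<lambda>t. pd i f (x + \<theta> *\<^sub>R axis i 1 + t *\<^sub>R axis j 1)) has_real_derivative
      pd j (pd i f) (x + \<theta> *\<^sub>R axis i 1 + t *\<^sub>R axis j 1)) (at t)" if "0 \<le> t" "t \<le> h" for t
    using f in_U[of \<theta> t] \<theta> that by (intro pd_exists_has_derivative) (auto simp: C2_on_def)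
  from MVT2[OF h this] obtain \<eta> where \<eta>: "0 < \<eta>" "\<eta> < h"
    "pd i f (x + \<theta> *\<^sub>R axis i 1 + h *\<^sub>R axis j 1) - pd i f (x + \<theta> *\<^sub>R axis i 1 + 0 *\<^sub>R axis j 1)
      = (h - 0) * pd j (pd i f) (x + \<theta> *\<^sub>R axis i 1 + \<eta> *\<^sub>R axis j 1)"
    by blast
  show ?thesis
  proof (rule that[of "x + \<theta> *\<^sub>R axis i 1 + \<eta> *\<^sub>R axis j 1"])
    show "dist (x + \<theta> *\<^sub>R axis i 1 + \<eta> *\<^sub>R axis j 1) x < 3 * h" using near \<theta> \<eta> by simp
    show "f (x + h *\<^sub>R axis i 1 + h *\<^sub>R axis j 1) - f (x + h *\<^sub>R axis i 1) - f (x + h *\<^sub>R axis j 1) + f x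
      = h\<^sup>2 * pd j (pd i f) (x + \<theta> *\<^sub>R axis i 1 + \<eta> *\<^sub>R axis j 1)"
      using \<theta>(3) \<eta>(3) by (simp add: \<phi>_def \<phi>'_def power2_eq_square add_ac)
  qed
qed

text \<open>\<open>Kcone\<close> demands symmetry, which \<open>hess\<close> does not have by
  construction.\<close>

lemma hess_symmetric:
  fixes f :: "real^'n \<Rightarrow> real"
  assumes U: "open U" "x \<in> U" and f: "C2_on U f"
  shows "transpose (hess f x) = hess f x"
proof -
  have "pd i (pd j f) x = pd j (pd i f) x" for i j
  proof (rule ccontr)
    assume ne: "pd i (pd j f) x \<noteq> pd j (pd i f) x"
    define e where "e = dist (pd i (pd j f) x) (pd j (pd i f) x) / 2"
    have e: "e > 0" using ne by (simp add: e_def)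
    obtain r where r: "r > 0" "ball x r \<subseteq> U" using U open_contains_ball by blast
    have "isCont (pd i (pd j f)) x" for i j
      using f U by (auto simp: C2_on_def continuous_on_eq_continuous_at)
    then have "\<exists>d>0. \<forall>y. dist y x < d \<longrightarrow> dist (pd i (pd j f) y) (pd i (pd j f) x) < e" for i j
      using e unfolding continuous_at_eps_delta by blast
    then obtain d1 d2 where d: "d1 > 0" "\<And>y. dist y x < d1 \<Longrightarrow> dist (pd i (pd j f) y) (pd i (pd j f) x) < e"
      "d2 > 0" "\<And>y. dist y x < d2 \<Longrightarrow> dist (pd j (pd i f) y) (pd j (pd i f) x) < e"
      by metis
    define h where "h = Min {r, d1, d2} / 3"
    have h: "h > 0" "3 * h \<le> r" "3 * h \<le> d1" "3 * h \<le> d2" using r d by (auto simp: h_def)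
    have ball: "ball x (3 * h) \<subseteq> U" using r(2) h by (meson order_trans subset_ball)
    obtain y where y: "dist y x < 3 * h"
      "f (x + h *\<^sub>R axis i 1 + h *\<^sub>R axis j 1) - f (x + h *\<^sub>R axis i 1) - f (x + h *\<^sub>R axis j 1) + f x
      = h\<^sup>2 * pd j (pd i f) y"
      using mixed_difference_mean_value[OF ball h(1) f] by blast
    obtain z where z: "dist z x < 3 * h"
      "f (x + h *\<^sub>R axis j 1 + h *\<^sub>R axis i 1) - f (x + h *\<^sub>R axis j 1) - f (x + h *\<^sub>R axis i 1) + f x
      = h\<^sup>2 * pd i (pd j f) z"
      using mixed_difference_mean_value[OF ball h(1) f] by blast
    have "h\<^sup>2 * pd j (pd i f) y = h\<^sup>2 * pd i (pd j f) z"
      unfolding y(2)[symmetric] z(2)[symmetric] by (simp add: add_ac)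
    then have "pd j (pd i f) y = pd i (pd j f) z" using h by simp
    moreover have "dist (pd i (pd j f) z) (pd i (pd j f) x) < e" using d(2)[of z] z h by simp
    moreover have "dist (pd j (pd i f) y) (pd j (pd i f) x) < e" using d(4)[of y] y h by simp
    ultimately show False
      using dist_triangle3[of "pd i (pd j f) x" "pd j (pd i f) x" "pd i (pd j f) z"] by (simp add: e_def)
  qed
  then show ?thesis by (simp add: hess_def transpose_def)
qed

lemma C21_on_slice:
  fixes u :: "real^'n \<Rightarrow> real \<Rightarrow> real"
  assumes "C21_on (\<Omega> \<times> {0<..}) u" "t > 0"
  shows "C2_on \<Omega> (\<lambda>y. u y t)"
proof -
  have slice: "continuous_on \<Omega> (\<lambda>x. F x t)" if "continuous_on (\<Omega> \<times> {0<..}) (\<lambda>(x,t). F x t)" for F :: "real^'n \<Rightarrow> real \<Rightarrow> real"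
  proof -
    have "continuous_on \<Omega> (\<lambda>x. (x, t))" by (intro continuous_intros)
    from continuous_on_compose2[OF that this] show ?thesis using assms(2) by auto
  qed
  show ?thesis
    using assms unfolding C21_on_def C2_on_def
    by (auto intro!: slice)
qed

section \<open>Comparison\<close>

lemma Kcone_antimono: "k \<le> m \<Longrightarrow> Kcone m \<subseteq> Kcone k"
  by (auto simp: Kcone_def)

text \<open>The inequality of \<open>Tsum_maclaurin\<close> survives limits, so a limit of \<open>(m - 1)\<close>-positive
  matrices on which \<open>- s T\<^bsub>m-1\<^esub> + T\<^sub>m\<close> is positive is again \<open>(m - 1)\<close>-positive.\<close>

lemma Kcone_propagates:
  fixes F :: "'a::topological_space \<Rightarrow> real^'n^'n"
  assumes conn: "connected Q" and cont: "continuous_on Q F" and m: "1 \<le> m"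
    and sym: "\<And>p. p \<in> Q \<Longrightarrow> transpose (F p) = F p"
    and pos: "\<And>p. p \<in> Q \<Longrightarrow> 0 < - g p * Tsum (m - 1) (F p) + Tsum m (F p)"
    and p0: "p0 \<in> Q" "F p0 \<in> Kcone (m - 1)" and p: "p \<in> Q"
  shows "F p \<in> Kcone (m - 1)"
proof (cases "m = 1")
  \<comment> \<open>Every symmetric matrix is 0-positive; for m = 1 the exponent m - 1 used below
    would be 0.\<close>
  case True
  then show ?thesis using sym p by (simp add: Kcone_def)
next
  case False
  with m have m2: "m \<ge> 2" by simp
  define V where "V = {p \<in> Q. F p \<in> Kcone (m - 1)}"
  define U where "U = (\<Inter>k\<in>{1..m-1}. {S :: real^'n^'n. 0 < Tsum k S})"
  \<comment> \<open>Closed counterpart of U: on Q both cut out V, which is therefore open and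
    closed. The \<open>max 0\<close> is there because a negative T_m may have a large even
    power.\<close>
  define C where "C = (\<Inter>k\<in>{..m-1}. {S :: real^'n^'n. 0 \<le> Tsum k S} \<inter> {S. Tsum (m-1) S ^ k \<le> Tsum k S ^ (m-1)})
     \<inter> {S. (max 0 (Tsum m S)) ^ (m-1) \<le> Tsum (m-1) S ^ m}"
  have "open U" unfolding U_def
    by (intro open_INT finite_atLeastAtMost ballI open_Collect_less continuous_intros)
  moreover have "V = Q \<inter> F -` U" using sym by (auto simp: V_def U_def Kcone_def)
  ultimately have "openin (top_of_set Q) V" using continuous_openin_preimage_gen[OF cont] by simp
  moreover have "closed C" unfolding C_def
    by (intro closed_INT closed_Int ballI closed_Collect_le continuous_intros)
  moreover have "V = Q \<inter> F -` C"
  proof (intro set_eqI iffI)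
    fix p assume "p \<in> V"
    then have Q: "p \<in> Q" and K: "F p \<in> Kcone (m - 1)" by (auto simp: V_def)
    have T: "0 < Tsum k (F p)" if "k \<le> m - 1" for k using Tsum_pos_Kcone[OF K that] .
    have "(max 0 (Tsum m (F p))) ^ (m-1) \<le> Tsum (m-1) (F p) ^ m"
    proof (cases "0 < Tsum m (F p)")
      case True
      have "F p \<in> Kcone m" unfolding Kcone_def
      proof (safe intro!: sym[OF Q])
        fix k assume "k \<in> {1..m}"
        then have "k = m \<or> k \<le> m - 1" by auto
        then show "0 < Tsum k (F p)" using True T by blast
      qed
      from Tsum_maclaurin[OF this, of "m - 1"] True show ?thesis by (simp add: max_def)
    next
      case False
      then have "max 0 (Tsum m (F p)) = 0" by simp
      then show ?thesis using m2 T[of "m - 1"] by (simp add: power_0_left)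
    qed
    then show "p \<in> Q \<inter> F -` C"
      using Q T Tsum_maclaurin[OF K] by (auto simp: C_def less_imp_le)
  next
    fix p assume p: "p \<in> Q \<inter> F -` C"
    then have Q: "p \<in> Q" by simp
    have T: "0 \<le> Tsum k (F p)" "Tsum (m-1) (F p) ^ k \<le> Tsum k (F p) ^ (m-1)" if "k \<le> m - 1" for k
      using p that by (auto simp: C_def)
    have top: "(max 0 (Tsum m (F p))) ^ (m-1) \<le> Tsum (m-1) (F p) ^ m" using p by (simp add: C_def)
    have "Tsum (m-1) (F p) \<noteq> 0"
    proof
      assume 0: "Tsum (m-1) (F p) = 0"
      then have "0 < Tsum m (F p)" using pos[OF Q] by simp
      then have "0 < (max 0 (Tsum m (F p))) ^ (m-1)" by simp
      with top 0 m2 show False by (simp add: power_0_left)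
    qed
    with T(1)[of "m-1"] have Tm: "0 < Tsum (m-1) (F p)" by simp
    \<comment> \<open>The other T_k follow from T_(m-1) > 0 by the Maclaurin inequalities stored in
      C.\<close>
    have "0 < Tsum k (F p)" if "k \<le> m - 1" for k
    proof -
      have "0 < Tsum k (F p) ^ (m-1)" using T(2)[OF that] zero_less_power[OF Tm, of k] by linarith
      then have "Tsum k (F p) \<noteq> 0" using m2 by (auto simp: power_0_left)
      with T(1)[OF that] show ?thesis by simp
    qed
    then show "p \<in> V" using Q sym[OF Q] by (simp add: V_def Kcone_def)
  qed
  ultimately have "closedin (top_of_set Q) V" "openin (top_of_set Q) V"
    using continuous_closedin_preimage[OF cont] by simp_all
  moreover have "V \<noteq> {}" using p0 by (auto simp: V_def)
  ultimately have "V = Q" using conn connected_clopen by blast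
  then show ?thesis using p by (auto simp: V_def)
qed

text \<open>The order starts from the smaller matrix S, so c = 0 is allowed. S is only (m -
  1)-positive: T_m is compared when it is positive and is trivially bounded otherwise.\<close>

lemma parabolic_upper_bound:
  fixes S H :: "real^'n^'n"
  assumes S: "S \<in> Kcone (m - 1)" and H: "H \<in> Kcone m" and psd: "psd (c *\<^sub>R H - S)"
    and c: "0 \<le> c" "c \<le> 1" and s: "- \<theta> \<le> s" and \<theta>: "0 \<le> \<theta>" and m: "1 \<le> m"
  shows "- s * Tsum (m - 1) S + Tsum m S \<le> \<theta> * Tsum (m - 1) H + c ^ m * Tsum m H"
proof -
  have TS: "0 < Tsum (m - 1) S" using Tsum_pos_Kcone[OF S] by simp
  have TH: "0 < Tsum k H" if "k \<le> m" for k using Tsum_pos_Kcone[OF H that] .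
  have "Tsum (m - 1) S \<le> Tsum (m - 1) (c *\<^sub>R H)"
    using Kcone_le_add_psd[OF S psd] by (simp add: Kcone_le_def)
  also have "\<dots> \<le> Tsum (m - 1) H"
    using TH[of "m - 1"] c by (simp add: Tsum_scaleR mult_left_le_one_le power_le_one)
  finally have "Tsum (m - 1) S \<le> Tsum (m - 1) H" .
  then have "- s * Tsum (m - 1) S \<le> \<theta> * Tsum (m - 1) H"
    using mult_right_mono[of "- s" \<theta> "Tsum (m - 1) S"] mult_left_mono[of "Tsum (m - 1) S" "Tsum (m - 1) H" \<theta>] s \<theta> TS
    by linarith
  moreover have "Tsum m S \<le> c ^ m * Tsum m H"
  proof (cases "0 < Tsum m S")
    case True
    have "S \<in> Kcone m" unfolding Kcone_def
    proof safe
      show "transpose S = S" using S by (simp add: Kcone_def)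
      fix k assume "k \<in> {1..m}"
      then have "k = m \<or> k \<le> m - 1" by auto
      then show "0 < Tsum k S" using True Tsum_pos_Kcone[OF S] by blast
    qed
    from Kcone_le_add_psd[OF this psd] have "Tsum m S \<le> Tsum m (c *\<^sub>R H)" by (simp add: Kcone_le_def)
    then show ?thesis by (simp add: Tsum_scaleR)
  next
    case False
    then show ?thesis using TH[of m] c by (smt (verit) mult_nonneg_nonneg zero_le_power order_refl)
  qed
  ultimately show ?thesis by simp
qed

text \<open>The quotients give T_(m-1)(S) \<le> T_m(S) T_(m-1)(H) / T_m(H), so the term with
  \<theta> costs only a fixed fraction of T_m(S). The bound on \<theta> keeps the remaining fraction
  nonnegative.\<close>

lemma parabolic_lower_bound:
  fixes S H :: "real^'n^'n"
  assumes H: "H \<in> Kcone m" and psd: "psd (S - c *\<^sub>R H)"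
    and c: "1 \<le> c" and s: "s \<le> \<theta>" and \<theta>: "0 \<le> \<theta>" "\<theta> * Tsum (m - 1) H \<le> Tsum m H" and m: "1 \<le> m"
  shows "c ^ m * (Tsum m H - \<theta> * Tsum (m - 1) H) \<le> - s * Tsum (m - 1) S + Tsum m S"
proof -
  have TH: "0 < Tsum k H" if "k \<le> m" for k using Tsum_pos_Kcone[OF H that] .
  have cH: "c *\<^sub>R H \<in> Kcone m"
    using H c TH by (auto simp: Kcone_def Tsum_scaleR transpose_scaleR)
  have le: "Kcone_le m (c *\<^sub>R H) S" using Kcone_le_add_psd[OF cH psd] by simp
  then have S: "S \<in> Kcone m" by (simp add: Kcone_le_def)
  define X Y x y where "X = Tsum m S" and "Y = Tsum (m - 1) S" and "x = Tsum m H" and "y = Tsum (m - 1) H"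
  have p: "0 < X" "0 < Y" "0 < x" "0 < y"
    using Tsum_pos_Kcone[OF S] TH by (auto simp: X_def Y_def x_def y_def)
  have Xx: "c ^ m * x \<le> X" using le by (simp add: Kcone_le_def Tsum_scaleR X_def x_def)
  have cm: "c ^ m = c * c ^ (m - 1)" using m by (cases m) auto
  have "(c ^ m * x) / (c ^ (m - 1) * y) \<le> X / Y"
    using le m unfolding Kcone_le_def X_def Y_def x_def y_def
    by (metis Suc_diff_1 Suc_le_eq Tsum_scaleR diff_less One_nat_def zero_less_one)
  then have "c * x / y \<le> X / Y" using c by (simp add: cm)
  then have "c * x * Y \<le> X * y" using p by (simp add: divide_simps mult_ac split: if_splits)
  moreover have "x * Y \<le> c * x * Y" using c p by simp
  ultimately have "x * Y \<le> X * y" by linarith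
  then have Y: "Y \<le> X * (y / x)" using p by (simp add: field_simps)
  have "c ^ m * (x - \<theta> * y) = (c ^ m * x) * (1 - \<theta> * (y / x))" using p by (simp add: field_simps)
  also have "\<dots> \<le> X * (1 - \<theta> * (y / x))"
    using Xx \<theta> p by (intro mult_right_mono) (auto simp: x_def y_def field_simps)
  also have "\<dots> = X - \<theta> * (X * (y / x))" by (simp add: algebra_simps)
  also have "\<dots> \<le> X - \<theta> * Y" using mult_left_mono[OF Y \<theta>(1)] by simp
  also have "\<dots> \<le> X - s * Y" using s p by simp
  finally show ?thesis by (simp add: X_def Y_def x_def y_def)
qed

text \<open>The maximum principle is applied to \<open>a u(x,t) - c v(x) + \<theta> t\<close>, and \<open>C\<close> comes from time \<open>\<tau>\<close>.\<close>

lemma parabolic_comparison: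
  fixes u :: "real^'n \<Rightarrow> real \<Rightarrow> real"
  assumes \<Omega>: "open \<Omega>" "bounded \<Omega>" and v: "C2_on \<Omega> v" "continuous_on (closure \<Omega>) v"
    and u: "C21_on (\<Omega> \<times> {0<..}) u" "continuous_on (closure \<Omega> \<times> {0..}) (\<lambda>(x,t). u x t)"
    and \<tau>: "0 < \<tau>" and \<theta>: "0 \<le> \<theta>"
    and interior: "\<And>x t. x \<in> \<Omega> \<Longrightarrow> \<tau> < t \<Longrightarrow> psd (c *\<^sub>R hess v x - a *\<^sub>R uxx u x t) \<Longrightarrow>
      - \<theta> \<le> a * ut u x t \<Longrightarrow> False"
    and boundary: "\<And>x t. x \<in> frontier \<Omega> \<Longrightarrow> \<tau> \<le> t \<Longrightarrow> a * u x t - c * v x \<le> B"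
  shows "\<exists>C. \<forall>x\<in>closure \<Omega>. \<forall>t\<ge>\<tau>. a * u x t - c * v x \<le> max (C - \<theta> * (t - \<tau>)) B"
proof (cases "\<Omega> = {}")
  case True
  then show ?thesis by simp
next
  case False
  have compact: "compact (closure \<Omega> \<times> {s..t})" for s t :: real
    using \<Omega>(2) by (intro compact_Times) auto
  define w where "w = (\<lambda>(x,t). a * u x t - c * v x + \<theta> * t)"
  have w_cont: "continuous_on (closure \<Omega> \<times> {\<tau>..T}) w" for T
  proof -
    have "continuous_on (closure \<Omega> \<times> {\<tau>..T}) (\<lambda>(x,t). u x t)"
      by (rule continuous_on_subset[OF u(2)]) (use \<tau> in auto)
    moreover have "continuous_on (closure \<Omega> \<times> {\<tau>..T}) (\<lambda>p. v (fst p))"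
      by (rule continuous_on_compose2[OF v(2) continuous_on_fst[OF continuous_on_id]]) auto
    ultimately show ?thesis unfolding w_def case_prod_beta by (intro continuous_intros)
  qed
  obtain p where "p \<in> closure \<Omega> \<times> {\<tau>..\<tau>}" "\<forall>q\<in>closure \<Omega> \<times> {\<tau>..\<tau>}. w q \<le> w p"
    using continuous_attains_sup[OF compact _ w_cont, of \<tau>] False by auto
  then have init: "a * u x \<tau> - c * v x + \<theta> * \<tau> \<le> w p" if "x \<in> closure \<Omega>" for x
    using that by (auto simp: w_def)
  show ?thesis
  proof (intro exI[of _ "w p - \<theta> * \<tau>"] ballI allI impI)
    fix x T assume x: "x \<in> closure \<Omega>" and T: "\<tau> \<le> T"
    \<comment> \<open>A bound for w on the initial slice and on the lateral boundary up to time
      T.\<close>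
    define M where "M = max (w p) (B + \<theta> * T)"
    obtain q where q: "q \<in> closure \<Omega> \<times> {\<tau>..T}" "\<And>r. r \<in> closure \<Omega> \<times> {\<tau>..T} \<Longrightarrow> w r \<le> w q"
    proof -
      have "closure \<Omega> \<times> {\<tau>..T} \<noteq> {}" using False T by simp
      from continuous_attains_sup[OF compact this w_cont] show ?thesis using that by blast
    qed
    obtain y t where yt: "q = (y, t)" "y \<in> closure \<Omega>" "\<tau> \<le> t" "t \<le> T" using q(1) by auto
    have max: "a * u z s - c * v z + \<theta> * s \<le> a * u y t - c * v y + \<theta> * t"
      if "z \<in> closure \<Omega>" "\<tau> \<le> s" "s \<le> T" for z s
      using q(2)[of "(z, s)"] that by (simp add: w_def yt(1))
    have "w q \<le> M"
    proof (rule ccontr)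
      assume "\<not> w q \<le> M"
      then have big: "M < a * u y t - c * v y + \<theta> * t" by (simp add: w_def yt(1))
      have "t \<noteq> \<tau>" using init[OF yt(2)] big by (auto simp: M_def)
      then have t: "\<tau> < t" using yt by simp
      have "y \<notin> frontier \<Omega>"
      proof
        assume "y \<in> frontier \<Omega>"
        then have "a * u y t - c * v y + \<theta> * t \<le> B + \<theta> * T"
          using boundary[of y t] yt mult_left_mono[OF yt(4) \<theta>] by simp
        then show False using big by (simp add: M_def)
      qed
      then have y: "y \<in> \<Omega>" using yt(2) \<Omega>(1) by (simp add: frontier_def interior_open)
      have ut: "C2_on \<Omega> (\<lambda>z. u z t)" using C21_on_slice[OF u(1)] t \<tau> by simp
      have "psd (c *\<^sub>R hess v y - a *\<^sub>R uxx u y t)"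
        unfolding psd_def
      proof (intro conjI allI)
        show "transpose (c *\<^sub>R hess v y - a *\<^sub>R uxx u y t) = c *\<^sub>R hess v y - a *\<^sub>R uxx u y t"
          unfolding uxx_def transpose_diff transpose_scaleR
          using hess_symmetric[OF \<Omega>(1) y v(1)] hess_symmetric[OF \<Omega>(1) y ut] by simp
        fix \<xi>
        have "\<xi> \<bullet> ((a *\<^sub>R hess (\<lambda>z. u z t) y - c *\<^sub>R hess v y) *v \<xi>) \<le> 0"
        proof (rule hess_difference_nonpos_at_max[OF \<Omega>(1) y ut v(1)])
          fix z assume "z \<in> \<Omega>"
          then have "z \<in> closure \<Omega>" using closure_subset by blast
          from max[OF this yt(3,4)] show "a * u z t - c * v z \<le> a * u y t - c * v y" by simp
        qed
        then show "0 \<le> \<xi> \<bullet> ((c *\<^sub>R hess v y - a *\<^sub>R uxx u y t) *v \<xi>)"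
          by (simp add: uxx_def matrix_vector_mult_diff_rdistrib inner_diff_right)
      qed
      \<comment> \<open>The maximum may lie at the final time T, so only earlier times are compared,
        and only a one-sided bound results.\<close>
      moreover have "- \<theta> \<le> a * ut u y t"
      proof (rule ccontr)
        assume neg: "\<not> - \<theta> \<le> a * ut u y t"
        have "(\<lambda>s. u y s) differentiable (at t)" using u(1) y t \<tau> unfolding C21_on_def by auto
        then have "((\<lambda>s. u y s) has_real_derivative ut u y t) (at t)"
          unfolding ut_def has_real_derivative_iff_has_vector_derivative by (simp add: vector_derivative_works)
        then have "((\<lambda>s. a * u y s + \<theta> * s) has_real_derivative a * ut u y t + \<theta>) (at t)"
          by (auto intro!: derivative_eq_intros)
        from DERIV_neg_dec_left[OF this] neg obtain d where d: "d > 0"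
          "\<And>h. 0 < h \<Longrightarrow> h < d \<Longrightarrow> a * u y t + \<theta> * t < a * u y (t - h) + \<theta> * (t - h)" by auto
        define h where "h = min d (t - \<tau>) / 2"
        have "0 < h" "h < d" "\<tau> \<le> t - h" using d(1) t by (auto simp: h_def min_def field_simps)
        then show False using d(2)[of h] max[OF yt(2), of "t - h"] yt(4) by fastforce
      qed
      ultimately show False using interior[OF y t] by blast
    qed
    moreover have "a * u x T - c * v x + \<theta> * T \<le> w q"
      using q(2)[of "(x, T)"] x T by (simp add: w_def)
    ultimately show "a * u x T - c * v x \<le> max (w p - \<theta> * \<tau> - \<theta> * (T - \<tau>)) B"
      by (simp add: M_def algebra_simps max_def split: if_splits)
  qed
qed

theorem theorem5p3:
  fixes \<Omega> :: "(real^'n) set" and m :: nat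
    and u0 :: "real^'n \<Rightarrow> real" and H :: "real^'n \<Rightarrow> real^'n^'n"
    and u :: "real^'n \<Rightarrow> real \<Rightarrow> real"
    and x0 :: "real^'n" and t0 \<nu> \<mu> :: real
    and h1 h2 hm :: "real \<Rightarrow> real"
  assumes dom: "open \<Omega>" "connected \<Omega>" "bounded \<Omega>" "\<Omega> \<noteq> {}"
    and m: "1 \<le> m" "m \<le> CARD('n)"
    and u0_C2: "C2_closure_with_hess \<Omega> u0 H"
    and u0_adm: "\<forall>x\<in>closure \<Omega>. H x \<in> Kcone m"
    and u_C21: "C21_on (\<Omega> \<times> {0<..}) u"
    and u_cont: "continuous_on (closure \<Omega> \<times> {0..}) (\<lambda>(x,t). u x t)"
    and x0: "x0 \<in> \<Omega>" "0 < t0"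
    and pos: "uxx u x0 t0 \<in> Kcone m"
    and nu_mu: "0 < \<nu>" "\<nu> \<le> \<mu>"
    and E_bounds: "\<forall>x\<in>\<Omega>. \<forall>t\<ge>t0. \<nu> \<le> Em m u x t \<and> Em m u x t \<le> \<mu>"
    and h_cont: "continuous_on {t0..} h1" "continuous_on {t0..} h2" "continuous_on {t0..} hm"
    and h_noninc: "\<forall>s\<ge>t0. \<forall>t\<ge>s. h1 t \<le> h1 s \<and> h2 t \<le> h2 s \<and> hm t \<le> hm s"
    and h_pos: "\<forall>t\<ge>t0. 0 < h1 t \<and> 0 < h2 t \<and> 0 < hm t"
    and h2_t0: "h2 t0 < 1 / real m"
    and init: "\<forall>x\<in>\<Omega>. - hm t0 \<le> u x t0 - u0 x \<and> u x t0 - u0 x \<le> h1 t0"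
    and bdry: "\<forall>x\<in>frontier \<Omega>. \<forall>t\<ge>t0. - hm t \<le> u x t - u0 x \<and> u x t - u0 x \<le> h1 t"
    and ratio: "\<forall>x\<in>\<Omega>. \<forall>t\<ge>t0.
        - hm t \<le> (1 / real m) * (1 - Em m u x t / Tsum m (H x)) \<and>
        (1 / real m) * (1 - Em m u x t / Tsum m (H x)) \<le> h2 t"
  shows "bdd_above ((\<lambda>(x,t). \<bar>u x t\<bar>) ` (closure \<Omega> \<times> {0..})) \<and>
    ((h1 \<longlongrightarrow> 0) at_top \<and> (h2 \<longlongrightarrow> 0) at_top \<and> (hm \<longlongrightarrow> 0) at_top \<longrightarrow>
      ((\<lambda>t. SUP x\<in>closure \<Omega>. \<bar>u x t - u0 x\<bar>) \<longlongrightarrow> 0) at_top)"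
proof -
  have v: "C2_on \<Omega> u0" "continuous_on (closure \<Omega>) u0" and H_cont: "continuous_on (closure \<Omega>) H"
    and H_hess: "\<And>x. x \<in> \<Omega> \<Longrightarrow> hess u0 x = H x"
    using u0_C2 by (auto simp: C2_closure_with_hess_def)
  have compact: "compact (closure \<Omega>)" using dom(3) by simp
  have ne: "closure \<Omega> \<noteq> {}" using dom(4) by simp
  have in_cl: "x \<in> closure \<Omega>" if "x \<in> \<Omega> \<or> x \<in> frontier \<Omega>" for x
    using that closure_subset by (auto simp: frontier_def)
  have HK: "H x \<in> Kcone m" if "x \<in> closure \<Omega>" for x using u0_adm that by blast
  have Hpos: "0 < Tsum k (H x)" if "x \<in> closure \<Omega>" "k \<le> m" for x k
    using Tsum_pos_Kcone[OF HK] that by blast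

  \<comment> \<open>Uniform constants of the stationary data\<close>
  obtain M where M: "1 \<le> M" "\<And>x. x \<in> closure \<Omega> \<Longrightarrow> \<bar>u0 x\<bar> \<le> M"
  proof -
    have "bounded (u0 ` closure \<Omega>)"
      using compact_continuous_image[OF v(2) compact] compact_imp_bounded by blast
    then obtain b where b: "\<And>x. x \<in> closure \<Omega> \<Longrightarrow> \<bar>u0 x\<bar> \<le> b" unfolding bounded_real by auto
    show ?thesis
      by (rule that[of "max 1 b"]) (use b in \<open>auto simp: le_max_iff_disj\<close>)
  qed
  obtain f0 where f0: "0 < f0" "\<And>x. x \<in> closure \<Omega> \<Longrightarrow> f0 \<le> Tsum m (H x)"
  proof -
    obtain y where "y \<in> closure \<Omega>" "\<forall>x\<in>closure \<Omega>. Tsum m (H y) \<le> Tsum m (H x)"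
      using continuous_attains_inf[OF compact ne continuous_on_Tsum[OF H_cont, of m]] by blast
    then show ?thesis using that Hpos[of y m] by blast
  qed
  obtain K where K: "0 < K" "\<And>x. x \<in> closure \<Omega> \<Longrightarrow> Tsum (m - 1) (H x) \<le> K"
  proof -
    obtain y where "y \<in> closure \<Omega>" "\<forall>x\<in>closure \<Omega>. Tsum (m - 1) (H x) \<le> Tsum (m - 1) (H y)"
      using continuous_attains_sup[OF compact ne continuous_on_Tsum[OF H_cont, of "m - 1"]] by blast
    then show ?thesis using that Hpos[of y "m - 1"] by force
  qed

  \<comment> \<open>(m - 1)-positivity of u_xx from time t0 on\<close>
  have uxx_sym: "transpose (uxx u x t) = uxx u x t" if "x \<in> \<Omega>" "0 < t" for x t
    unfolding uxx_def by (rule hess_symmetric[OF dom(1) that(1) C21_on_slice[OF u_C21 that(2)]])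
  have cone: "uxx u x t \<in> Kcone (m - 1)" if "x \<in> \<Omega>" "t0 \<le> t" for x t
  proof -
    have conn: "connected (\<Omega> \<times> {t0..})" using dom(2) by (intro connected_Times) auto
    have cont: "continuous_on (\<Omega> \<times> {t0..}) (\<lambda>p. uxx u (fst p) (snd p))"
    proof (rule continuous_on_subset)
      show "continuous_on (\<Omega> \<times> {0<..}) (\<lambda>p. uxx u (fst p) (snd p))"
        using u_C21 unfolding C21_on_def uxx_def hess_def case_prod_beta
        by (intro continuous_on_vec_lambda) blast
      show "\<Omega> \<times> {t0..} \<subseteq> \<Omega> \<times> {0<..}" using x0 by auto
    qed
    have "uxx u (fst (x, t)) (snd (x, t)) \<in> Kcone (m - 1)"
    proof (rule Kcone_propagates[where F = "\<lambda>p. uxx u (fst p) (snd p)" and p = "(x, t)"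
          and g = "\<lambda>p. ut u (fst p) (snd p)" and p0 = "(x0, t0)", OF conn cont m(1)])
      fix p assume p: "p \<in> \<Omega> \<times> {t0..}"
      then show "transpose (uxx u (fst p) (snd p)) = uxx u (fst p) (snd p)"
        using uxx_sym x0 by auto
      have "\<nu> \<le> Em m u (fst p) (snd p)" using p E_bounds by auto
      then show "0 < - ut u (fst p) (snd p) * Tsum (m - 1) (uxx u (fst p) (snd p)) + Tsum m (uxx u (fst p) (snd p))"
        using nu_mu(1) by (simp add: Em_def)
    next
      show "uxx u (fst (x0, t0)) (snd (x0, t0)) \<in> Kcone (m - 1)"
        using pos Kcone_antimono[of "m - 1" m] by auto
    qed (use x0 that in auto)
    then show ?thesis by simp
  qed

  have E_lower: "Tsum m (H x) * (1 - m * h2 t) \<le> Em m u x t"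
    and E_upper: "Em m u x t \<le> Tsum m (H x) * (1 + m * hm t)" if "x \<in> \<Omega>" "t0 \<le> t" for x t
  proof -
    have "0 < Tsum m (H x)" using Hpos in_cl that by blast
    moreover have "0 < real m" using m by simp
    moreover have "- hm t \<le> (1 / real m) * (1 - Em m u x t / Tsum m (H x))"
        "(1 / real m) * (1 - Em m u x t / Tsum m (H x)) \<le> h2 t" using ratio that by blast+
    ultimately show "Tsum m (H x) * (1 - m * h2 t) \<le> Em m u x t" "Em m u x t \<le> Tsum m (H x) * (1 + m * hm t)"
      by (simp_all add: field_simps)
  qed
  have h_mono: "h1 t \<le> h1 s" "h2 t \<le> h2 s" "hm t \<le> hm s" if "t0 \<le> s" "s \<le> t" for s t
    using h_noninc that by blast+

  \<comment> \<open>One-sided comparison with multiples of u0\<close>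
  have upper: "\<exists>C. \<forall>x\<in>closure \<Omega>. \<forall>t\<ge>\<tau>. u x t - c * u0 x \<le> max (C - \<theta> * (t - \<tau>)) B"
    if \<tau>: "t0 \<le> \<tau>" and \<theta>: "0 \<le> \<theta>" and c: "0 \<le> c" "c \<le> 1"
      and strict: "\<And>x. x \<in> closure \<Omega> \<Longrightarrow> \<theta> * Tsum (m - 1) (H x) + c ^ m * Tsum m (H x) < Tsum m (H x) * (1 - m * h2 \<tau>)"
      and B: "h1 \<tau> + (1 - c) * M \<le> B" for \<tau> \<theta> c B
  proof -
    have int: False
      if x: "x \<in> \<Omega>" and t: "\<tau> < t" and psd: "psd (c *\<^sub>R hess u0 x - 1 *\<^sub>R uxx u x t)"
        and ut: "- \<theta> \<le> 1 * ut u x t" for x t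
    proof -
      have "Em m u x t \<le> \<theta> * Tsum (m - 1) (H x) + c ^ m * Tsum m (H x)"
        unfolding Em_def
        by (rule parabolic_upper_bound[OF cone HK]) (use x t \<tau> psd c ut \<theta> m in_cl H_hess in auto)
      also have "\<dots> < Tsum m (H x) * (1 - m * h2 \<tau>)" using strict in_cl x by blast
      also have "\<dots> \<le> Tsum m (H x) * (1 - m * h2 t)"
        using h_mono(2)[of \<tau> t] \<tau> t Hpos[of x m] in_cl x by (intro mult_left_mono) (auto intro!: mult_left_mono)
      also have "\<dots> \<le> Em m u x t" using E_lower[OF x] \<tau> t by simp
      finally show False by simp
    qed
    \<comment> \<open>From u - c u0 = (u - u0) + (1 - c) u0; this is the origin of (1 - c) M in the
      condition on B.\<close>
    have bd: "1 * u x t - c * u0 x \<le> B" if "x \<in> frontier \<Omega>" "\<tau> \<le> t" for x t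
    proof -
      have "u x t - u0 x \<le> h1 t" using bdry that \<tau> by auto
      then have "u x t - u0 x \<le> h1 \<tau>" using h_mono(1)[OF \<tau> that(2)] by linarith
      moreover have "(1 - c) * u0 x \<le> (1 - c) * M" using M(2)[of x] in_cl that c by (intro mult_left_mono) auto
      ultimately show ?thesis using B by (simp add: algebra_simps)
    qed
    have "0 < \<tau>" using \<tau> x0 by simp
    then have "\<exists>C. \<forall>x\<in>closure \<Omega>. \<forall>t\<ge>\<tau>. 1 * u x t - c * u0 x \<le> max (C - \<theta> * (t - \<tau>)) B"
      using \<theta> int bd by (rule parabolic_comparison[OF dom(1,3) v u_C21 u_cont])
    then show ?thesis by simp
  qed

  have lower: "\<exists>C. \<forall>x\<in>closure \<Omega>. \<forall>t\<ge>\<tau>. c * u0 x - u x t \<le> max (C - \<theta> * (t - \<tau>)) B"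
    if \<tau>: "t0 \<le> \<tau>" and \<theta>: "0 \<le> \<theta>" and c: "1 \<le> c"
      and small: "\<And>x. x \<in> closure \<Omega> \<Longrightarrow> \<theta> * Tsum (m - 1) (H x) \<le> Tsum m (H x)"
      and strict: "\<And>x. x \<in> closure \<Omega> \<Longrightarrow> Tsum m (H x) * (1 + m * hm \<tau>) < c ^ m * (Tsum m (H x) - \<theta> * Tsum (m - 1) (H x))"
      and B: "hm \<tau> + (c - 1) * M \<le> B" for \<tau> \<theta> c B
  proof -
    \<comment> \<open>The coefficients -1 and -c turn the minimum of u - c u0 - \<theta> t into a
      maximum.\<close>
    have int: False
      if x: "x \<in> \<Omega>" and t: "\<tau> < t" and psd: "psd ((- c) *\<^sub>R hess u0 x - (- 1) *\<^sub>R uxx u x t)"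
        and ut: "- \<theta> \<le> (- 1) * ut u x t" for x t
    proof -
      have "Em m u x t \<le> Tsum m (H x) * (1 + m * hm t)" using E_upper[OF x] \<tau> t by simp
      also have "\<dots> \<le> Tsum m (H x) * (1 + m * hm \<tau>)"
        using h_mono(3)[of \<tau> t] \<tau> t Hpos[of x m] in_cl x by (intro mult_left_mono) (auto intro!: mult_left_mono)
      also have "\<dots> < c ^ m * (Tsum m (H x) - \<theta> * Tsum (m - 1) (H x))" using strict in_cl x by blast
      also have "\<dots> \<le> Em m u x t"
        unfolding Em_def
        by (rule parabolic_lower_bound[OF HK]) (use x psd c ut \<theta> m in_cl H_hess small in auto)
      finally show False by simp
    qed
    have bd: "(- 1) * u x t - (- c) * u0 x \<le> B" if "x \<in> frontier \<Omega>" "\<tau> \<le> t" for x t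
    proof -
      have "- hm t \<le> u x t - u0 x" using bdry that \<tau> by auto
      then have "u0 x - u x t \<le> hm \<tau>" using h_mono(3)[OF \<tau> that(2)] by linarith
      moreover have "(c - 1) * u0 x \<le> (c - 1) * M" using M(2)[of x] in_cl that c by (intro mult_left_mono) auto
      ultimately show ?thesis using B by (simp add: algebra_simps)
    qed
    have "0 < \<tau>" using \<tau> x0 by simp
    then have "\<exists>C. \<forall>x\<in>closure \<Omega>. \<forall>t\<ge>\<tau>. (- 1) * u x t - (- c) * u0 x \<le> max (C - \<theta> * (t - \<tau>)) B"
      using \<theta> int bd by (rule parabolic_comparison[OF dom(1,3) v u_C21 u_cont])
    then show ?thesis by (simp add: algebra_simps)
  qed

  \<comment> \<open>Boundedness\<close>
  have "bdd_above ((\<lambda>(x,t). \<bar>u x t\<bar>) ` (closure \<Omega> \<times> {0..}))"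
  proof -
    \<comment> \<open>This makes the lower bound for E_m[u] positive, so that c = 0 with \<theta> =
      0 is strict.\<close>
    have mh: "m * h2 t0 < 1" using h2_t0 m by (simp add: field_simps)
    have "0 < Tsum m (H x) * (1 - m * h2 t0)" if "x \<in> closure \<Omega>" for x
      using Hpos[OF that, of m] mh by simp
    then obtain C1 where C1: "\<forall>x\<in>closure \<Omega>. \<forall>t\<ge>t0. u x t - 0 * u0 x \<le> max (C1 - 0 * (t - t0)) (h1 t0 + M)"
      using upper[of t0 0 0 "h1 t0 + M"] m by (auto simp: power_0_left)
    \<comment> \<open>Bernoulli's inequality for 1 + (1 + hm(t0)) yields 1 + m (1 + hm(t0)), which
      exceeds the factor 1 + m hm(t0) in the upper bound for E_m[u].\<close>
    define c where "c = 2 + hm t0"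
    have hm0: "0 < hm t0" using h_pos by simp
    have "Tsum m (H x) * (1 + m * hm t0) < c ^ m * (Tsum m (H x) - 0 * Tsum (m - 1) (H x))" if "x \<in> closure \<Omega>" for x
    proof -
      have "1 + m * hm t0 < 1 + m * (1 + hm t0)" using m by (simp add: algebra_simps)
      also have "\<dots> \<le> (1 + (1 + hm t0)) ^ m" using hm0 by (intro Bernoulli_inequality) simp
      finally show ?thesis using Hpos[OF that, of m] by (simp add: c_def mult.commute[of "Tsum m _"])
    qed
    then obtain C2 where C2: "\<forall>x\<in>closure \<Omega>. \<forall>t\<ge>t0. c * u0 x - u x t \<le> max (C2 - 0 * (t - t0)) (hm t0 + (c - 1) * M)"
      using lower[of t0 0 c "hm t0 + (c - 1) * M"] Hpos hm0 by (auto simp: c_def less_imp_le)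
    have "compact (closure \<Omega> \<times> {0..t0})" using compact by (intro compact_Times) auto
    moreover have "continuous_on (closure \<Omega> \<times> {0..t0}) (\<lambda>(x,t). u x t)"
      by (rule continuous_on_subset[OF u_cont]) auto
    ultimately have "bounded ((\<lambda>(x,t). u x t) ` (closure \<Omega> \<times> {0..t0}))"
      using compact_continuous_image compact_imp_bounded by blast
    then obtain C3 where C3: "\<And>x t. x \<in> closure \<Omega> \<Longrightarrow> 0 \<le> t \<Longrightarrow> t \<le> t0 \<Longrightarrow> \<bar>u x t\<bar> \<le> C3"
      unfolding bounded_real by fastforce
    define B where "B = max C3 (max (max C1 (h1 t0 + M)) (max C2 (hm t0 + (c - 1) * M) + c * M))"
    have "\<bar>u x t\<bar> \<le> B" if x: "x \<in> closure \<Omega>" and t: "0 \<le> t" for x t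
    proof (cases "t \<le> t0")
      case True
      then show ?thesis using C3[OF x t] by (simp add: B_def)
    next
      case False
      then have "u x t \<le> max C1 (h1 t0 + M)" "c * u0 x - u x t \<le> max C2 (hm t0 + (c - 1) * M)"
        using C1 C2 x by force+
      moreover have "- (c * u0 x) \<le> c * M" 
        using mult_left_mono[of "- u0 x" M c] M(2)[OF x] hm0 by (simp add: c_def)
      ultimately show ?thesis unfolding B_def by linarith
    qed
    then show ?thesis by (intro bdd_aboveI[of _ B]) auto
  qed

  \<comment> \<open>Convergence\<close>
  moreover have "((\<lambda>t. SUP x\<in>closure \<Omega>. \<bar>u x t - u0 x\<bar>) \<longlongrightarrow> 0) at_top"
    if h: "(h1 \<longlongrightarrow> 0) at_top" "(h2 \<longlongrightarrow> 0) at_top" "(hm \<longlongrightarrow> 0) at_top"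
  proof -
    have ev: "\<forall>\<^sub>F t in at_top. \<forall>x\<in>closure \<Omega>. \<bar>u x t - u0 x\<bar> \<le> \<delta>" if \<delta>: "\<delta> > 0" for \<delta>
    proof -
      \<comment> \<open>Passing between u0 and (1 - \<epsilon>) u0 or (1 + \<epsilon>) u0 costs at
        most \<delta> / 4. With h1, hm < \<delta> / 4 at \<tau> the boundary bound is \<delta> /
        2.\<close>
      define \<epsilon> where "\<epsilon> = min (1 / 2) (\<delta> / (4 * M))"
      have \<epsilon>: "0 < \<epsilon>" "\<epsilon> \<le> 1 / 2" "\<epsilon> * M \<le> \<delta> / 4"
        using \<delta> M(1) by (auto simp: \<epsilon>_def min_def field_simps)
      have mpos: "0 < real m" using m by simp
      have "\<forall>\<^sub>F t in at_top. t0 \<le> t \<and> h1 t < \<delta> / 4 \<and> h2 t < \<epsilon> / (2 * m) \<and> hm t < \<epsilon> / 2 \<and> hm t < \<delta> / 4"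
        using order_tendstoD(2)[OF h(1), of "\<delta> / 4"] order_tendstoD(2)[OF h(2), of "\<epsilon> / (2 * m)"]
          order_tendstoD(2)[OF h(3), of "\<epsilon> / 2"] order_tendstoD(2)[OF h(3), of "\<delta> / 4"] \<epsilon>(1) \<delta> mpos
        by (simp add: eventually_conj_iff eventually_ge_at_top)
      from eventually_happens'[OF trivial_limit_at_top_linorder this]
      obtain \<tau> where \<tau>: "t0 \<le> \<tau>" "h1 \<tau> < \<delta> / 4" "h2 \<tau> < \<epsilon> / (2 * m)" "hm \<tau> < \<epsilon> / 2" "hm \<tau> < \<delta> / 4"
        by blast
      \<comment> \<open>Calibrated so that \<theta> T_(m-1)(H) is at most the fraction \<epsilon> /
        8 of T_m(H) everywhere.\<close>
      define \<theta> where "\<theta> = f0 * \<epsilon> / (8 * K)"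
      have \<theta>: "0 < \<theta>" using f0 K \<epsilon> by (simp add: \<theta>_def)
      have \<theta>T: "\<theta> * Tsum (m - 1) (H x) \<le> Tsum m (H x) * (\<epsilon> / 8)" if "x \<in> closure \<Omega>" for x
      proof -
        have "\<theta> * Tsum (m - 1) (H x) \<le> \<theta> * K" using K(2)[OF that] \<theta> by simp
        also have "\<dots> = f0 * (\<epsilon> / 8)" using K(1) by (simp add: \<theta>_def)
        also have "\<dots> \<le> Tsum m (H x) * (\<epsilon> / 8)" using f0(2)[OF that] \<epsilon> by (intro mult_right_mono) auto
        finally show ?thesis .
      qed
      obtain C1 where C1: "\<forall>x\<in>closure \<Omega>. \<forall>t\<ge>\<tau>. u x t - (1 - \<epsilon>) * u0 x \<le> max (C1 - \<theta> * (t - \<tau>)) (\<delta> / 2)"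
      proof -
        have "\<theta> * Tsum (m - 1) (H x) + (1 - \<epsilon>) ^ m * Tsum m (H x) < Tsum m (H x) * (1 - m * h2 \<tau>)"
          if x: "x \<in> closure \<Omega>" for x
        proof -
          \<comment> \<open>The gap \<epsilon> left by the multiple pays \<epsilon> / 8 for \<theta>
            and less than \<epsilon> / 2 for h2.\<close>
          have "(1 - \<epsilon>) ^ m \<le> (1 - \<epsilon>) ^ 1" using \<epsilon> m by (intro power_decreasing) auto
          moreover have "m * h2 \<tau> < \<epsilon> / 2" using \<tau>(3) mpos by (simp add: field_simps)
          ultimately have "\<epsilon> / 8 + (1 - \<epsilon>) ^ m < 1 - m * h2 \<tau>" using \<epsilon> by simp
          then have "Tsum m (H x) * (\<epsilon> / 8 + (1 - \<epsilon>) ^ m) < Tsum m (H x) * (1 - m * h2 \<tau>)"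
            using Hpos[OF x, of m] by (intro mult_strict_left_mono) auto
          then show ?thesis using \<theta>T[OF x] by (simp add: algebra_simps)
        qed
        then show ?thesis using upper[of \<tau> \<theta> "1 - \<epsilon>" "\<delta> / 2"] \<tau> \<theta> \<epsilon> that by auto
      qed
      obtain C2 where C2: "\<forall>x\<in>closure \<Omega>. \<forall>t\<ge>\<tau>. (1 + \<epsilon>) * u0 x - u x t \<le> max (C2 - \<theta> * (t - \<tau>)) (\<delta> / 2)"
      proof -
        have "Tsum m (H x) * (1 + m * hm \<tau>) < (1 + \<epsilon>) ^ m * (Tsum m (H x) - \<theta> * Tsum (m - 1) (H x))"
          if x: "x \<in> closure \<Omega>" for x
        proof -
          \<comment> \<open>Bernoulli's inequality gives (1 + \<epsilon>)^m \<ge> 1 + y. Half of y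
            pays for hm, and the other half outweighs the loss (1 + y) \<epsilon> / 8 caused by
            \<theta>.\<close>
          define y where "y = m * \<epsilon>"
          have "1 * \<epsilon> \<le> m * \<epsilon>" using m \<epsilon> by (intro mult_right_mono) auto
          then have y: "\<epsilon> \<le> y" by (simp add: y_def)
          have "m * hm \<tau> < y / 2" using \<tau>(4) mpos by (simp add: y_def)
          moreover have "1 + y / 2 \<le> (1 + y) * (1 - \<epsilon> / 8)"
          proof -
            have "y * \<epsilon> \<le> y * (1/2)" using y \<epsilon> by (intro mult_left_mono) auto
            moreover have "(1 + y) * (1 - \<epsilon> / 8) = 1 + y - \<epsilon> / 8 - y * \<epsilon> / 8"
              by (simp add: field_simps)
            ultimately show ?thesis using y \<epsilon> by linarith
          qed
          moreover have "(1 + y) * (1 - \<epsilon> / 8) \<le> (1 + \<epsilon>) ^ m * (1 - \<epsilon> / 8)"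
            unfolding y_def using \<epsilon> by (intro mult_right_mono Bernoulli_inequality) auto
          ultimately have "1 + m * hm \<tau> < (1 + \<epsilon>) ^ m * (1 - \<epsilon> / 8)" by linarith
          then have "Tsum m (H x) * (1 + m * hm \<tau>) < Tsum m (H x) * ((1 + \<epsilon>) ^ m * (1 - \<epsilon> / 8))"
            using Hpos[OF x, of m] by (intro mult_strict_left_mono) auto
          also have "\<dots> = (1 + \<epsilon>) ^ m * (Tsum m (H x) - Tsum m (H x) * (\<epsilon> / 8))" by (simp add: algebra_simps)
          also have "\<dots> \<le> (1 + \<epsilon>) ^ m * (Tsum m (H x) - \<theta> * Tsum (m - 1) (H x))"
            using \<theta>T[OF x] \<epsilon> by (intro mult_left_mono) auto
          finally show ?thesis .
        qed
        moreover have "\<theta> * Tsum (m - 1) (H x) \<le> Tsum m (H x)" if x: "x \<in> closure \<Omega>" for x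
        proof -
          have "Tsum m (H x) * (\<epsilon> / 8) \<le> Tsum m (H x) * 1"
            using Hpos[OF x, of m] \<epsilon> by (intro mult_left_mono) auto
          then show ?thesis using \<theta>T[OF x] by simp
        qed
        ultimately show ?thesis using lower[of \<tau> \<theta> "1 + \<epsilon>" "\<delta> / 2"] \<tau> \<theta> \<epsilon> that by auto
      qed
      \<comment> \<open>From this time on \<theta> (t - \<tau>) exceeds both constants inherited
        from time \<tau>.\<close>
      define T where "T = \<tau> + (\<bar>C1\<bar> + \<bar>C2\<bar>) / \<theta>"
      have "\<bar>u x t - u0 x\<bar> \<le> \<delta>" if x: "x \<in> closure \<Omega>" and t: "T \<le> t" for x t
      proof -
        have "(\<bar>C1\<bar> + \<bar>C2\<bar>) / \<theta> \<le> t - \<tau>" using t by (simp add: T_def)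
        then have "\<bar>C1\<bar> + \<bar>C2\<bar> \<le> \<theta> * (t - \<tau>)" using \<theta> by (simp add: field_simps)
        then have C: "C1 - \<theta> * (t - \<tau>) \<le> \<delta> / 2" "C2 - \<theta> * (t - \<tau>) \<le> \<delta> / 2" using \<delta> by linarith+
        have "0 \<le> (\<bar>C1\<bar> + \<bar>C2\<bar>) / \<theta>" using \<theta> by simp
        then have "\<tau> \<le> t" using t by (simp add: T_def)
        then have "u x t - (1 - \<epsilon>) * u0 x \<le> max (C1 - \<theta> * (t - \<tau>)) (\<delta> / 2)"
            "(1 + \<epsilon>) * u0 x - u x t \<le> max (C2 - \<theta> * (t - \<tau>)) (\<delta> / 2)"
          using C1 C2 x by blast+
        then have "u x t - (1 - \<epsilon>) * u0 x \<le> \<delta> / 2" "(1 + \<epsilon>) * u0 x - u x t \<le> \<delta> / 2"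
          unfolding max_absorb2[OF C(1)] max_absorb2[OF C(2)] .
        moreover have "\<bar>\<epsilon> * u0 x\<bar> \<le> \<delta> / 4"
        proof -
          have "\<bar>\<epsilon> * u0 x\<bar> = \<epsilon> * \<bar>u0 x\<bar>" using \<epsilon> by (simp add: abs_mult)
          also have "\<dots> \<le> \<epsilon> * M" using M(2)[OF x] \<epsilon> by (intro mult_left_mono) auto
          finally show ?thesis using \<epsilon>(3) by linarith
        qed
        ultimately show ?thesis using \<delta> unfolding left_diff_distrib distrib_right mult_1 by linarith
      qed
      then show ?thesis unfolding eventually_at_top_linorder by blast
    qed
    show ?thesis
    proof (rule tendstoI)
      fix e :: real assume e: "e > 0"
      have "\<forall>\<^sub>F t in at_top. \<forall>x\<in>closure \<Omega>. \<bar>u x t - u0 x\<bar> \<le> e / 2" using ev[of "e / 2"] e by simp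
      then show "\<forall>\<^sub>F t in at_top. dist (SUP x\<in>closure \<Omega>. \<bar>u x t - u0 x\<bar>) 0 < e"
      proof eventually_elim
        case (elim t)
        \<comment> \<open>One point of the closure suffices to see that the supremum is
          nonnegative.\<close>
        have z: "x0 \<in> closure \<Omega>" using in_cl x0(1) by blast
        have "(SUP x\<in>closure \<Omega>. \<bar>u x t - u0 x\<bar>) \<le> e / 2" using elim ne by (intro cSUP_least) auto
        moreover have "\<bar>u x0 t - u0 x0\<bar> \<le> (SUP x\<in>closure \<Omega>. \<bar>u x t - u0 x\<bar>)"
          using elim z by (intro cSUP_upper bdd_aboveI2[where M = "e / 2"]) auto
        ultimately show ?case using e by (simp add: abs_le_iff)
      qed
    qed
  qed
  ultimately show ?thesis by blast
qed

end
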